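(* Let $X$ be a hereditarily indecomposable Banach space over $\mathbb{K}=\mathbb{R}$ or $\mathbb{C}$ and let $Y,Z$ be two (infinite-dimensional closed) subspaces of $X$ that are isomorphic. Then there is an into isomorphism $T\colon Y\to X$ with $T(Y)=Z$ such that $T$ is homotopic in $\mathrm{Emb}(Y,X)$ to the inclusion map $\mathrm{i}_{Y,X}\colon Y\to X$.
   Context: An infinite-dimensional Banach space is hereditarily indecomposable (HI) if no two infinite-dimensional closed subspaces of it are in topological direct sum. All operators are bounded and linear. An operator $T\colon Y\to X$ is an into isomorphism if there is $c>0$ with $\|T(y)\|\geqslant c\|y\|$ for all $y\in Y$. $\mathrm{Emb}(Y,X)$ is the set of all into isomorphisms $Y\to X$, with the operator-norm topology. Two elements $S,T\in\mathrm{Emb}(Y,X)$ are homotopic in $\mathrm{Emb}(Y,X)$ if there is a continuous map $[0,1]\to\mathrm{Emb}(Y,X)$, $t\mapsto T_t$, with $T_0=S$ and $T_1=T$. *)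

theory Defs
  imports "HOL-Analysis.Analysis"
begin

definition topological_direct_sum :: "'a::banach set \<Rightarrow> 'a set \<Rightarrow> bool" where
  "topological_direct_sum Y Z \<longleftrightarrow> Y \<inter> Z = {0} \<and>
    (\<exists>g. homeomorphism (Y \<times> Z) {y + z | y z. y \<in> Y \<and> z \<in> Z} (\<lambda>(y, z). y + z) g)"

definition inclusion :: "'a set \<Rightarrow> 'a \<Rightarrow> 'a" where
  "inclusion Y = (\<lambda>y\<in>Y. y)"

(* A Banach space over 'k: the completeness and the norm come from the class banach. The theorem
   uses 'k = real, where scale is forced to be scaleR, and 'k = complex. *)
locale banach_space = vector_space scale
  for scale :: "'k::real_normed_field \<Rightarrow> 'a::banach \<Rightarrow> 'a"  (infixr "*\<^sub>K" 75) +
  assumes scale_of_real: "of_real r *\<^sub>K x = r *\<^sub>R x"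
    and norm_scale: "norm (c *\<^sub>K x) = norm c * norm x"
begin

(* Here and below, subspace and span are those of the 'k-vector space, not of the underlying
   real one. *)
definition inf_dim_closed_subspace :: "'a set \<Rightarrow> bool" where
  "inf_dim_closed_subspace Y \<longleftrightarrow> subspace Y \<and> closed Y \<and> \<not> (\<exists>B. finite B \<and> span B = Y)"

definition hereditarily_indecomposable :: bool where
  "hereditarily_indecomposable \<longleftrightarrow> inf_dim_closed_subspace UNIV \<and>
    \<not> (\<exists>Y Z. inf_dim_closed_subspace Y \<and> inf_dim_closed_subspace Z \<and> topological_direct_sum Y Z)"

(* The bounded linear operators from the subspace Y to the subspace W. The extensional function
   space makes an operator determined by its values on Y. *)
definition operators :: "'a set \<Rightarrow> 'a set \<Rightarrow> ('a \<Rightarrow> 'a) set" where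
  "operators Y W = {T \<in> Y \<rightarrow>\<^sub>E W.
    (\<forall>x\<in>Y. \<forall>y\<in>Y. T (x + y) = T x + T y) \<and>
    (\<forall>c. \<forall>y\<in>Y. T (c *\<^sub>K y) = c *\<^sub>K T y) \<and>
    (\<exists>C. \<forall>y\<in>Y. norm (T y) \<le> C * norm y)}"

definition isomorphic :: "'a set \<Rightarrow> 'a set \<Rightarrow> bool" where
  "isomorphic Y Z \<longleftrightarrow> (\<exists>T\<in>operators Y Z. \<exists>S\<in>operators Z Y.
    (\<forall>y\<in>Y. S (T y) = y) \<and> (\<forall>z\<in>Z. T (S z) = z))"

(* Emb(Y, X), where X is the whole space UNIV. *)
definition Emb :: "'a set \<Rightarrow> ('a \<Rightarrow> 'a) set" where
  "Emb Y = {T \<in> operators Y UNIV. \<exists>c>0. \<forall>y\<in>Y. norm (T y) \<ge> c * norm y}"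

(* The operator norm of S - T on Y; the quotient is 0 at y = 0. The value outside Emb Y is
   irrelevant, but Metric_space wants a distance that is nonnegative everywhere. *)
definition Emb_dist :: "'a set \<Rightarrow> ('a \<Rightarrow> 'a) \<Rightarrow> ('a \<Rightarrow> 'a) \<Rightarrow> real" where
  "Emb_dist Y S T =
    (if S \<in> Emb Y \<and> T \<in> Emb Y then SUP y\<in>Y. norm (S y - T y) / norm y else 0)"

definition Emb_topology :: "'a set \<Rightarrow> ('a \<Rightarrow> 'a) topology" where
  "Emb_topology Y = Metric_space.mtopology (Emb Y) (Emb_dist Y)"

definition homotopic_in_Emb :: "'a set \<Rightarrow> ('a \<Rightarrow> 'a) \<Rightarrow> ('a \<Rightarrow> 'a) \<Rightarrow> bool" where
  "homotopic_in_Emb Y S T \<longleftrightarrow> (\<exists>g. pathin (Emb_topology Y) g \<and> g 0 = S \<and> g 1 = T)"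

lemma inclusion_in_Emb:
  assumes "subspace Y"
  shows "inclusion Y \<in> Emb Y"
proof -
  have "inclusion Y \<in> operators Y UNIV"
    using assms unfolding operators_def inclusion_def
    by (auto simp: subspace_add subspace_scale intro!: exI[of _ 1])
  then show ?thesis
    unfolding Emb_def inclusion_def by (auto intro!: exI[of _ 1])
qed

lemma Emb_dist_bdd:
  assumes "S \<in> Emb Y" "T \<in> Emb Y"
  shows "bdd_above ((\<lambda>y. norm (S y - T y) / norm y) ` Y)"
proof -
  obtain C D where C: "\<And>y. y \<in> Y \<Longrightarrow> norm (S y) \<le> C * norm y"
    and D: "\<And>y. y \<in> Y \<Longrightarrow> norm (T y) \<le> D * norm y"
    using assms unfolding Emb_def operators_def mem_Collect_eq by metis
  have "norm (S y - T y) / norm y \<le> max 0 (C + D)" if "y \<in> Y" for y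
  proof (cases "y = 0")
    case False
    have "norm (S y - T y) \<le> (C + D) * norm y"
      using norm_triangle_ineq4[of "S y" "T y"] C[OF that] D[OF that]
      by (simp add: algebra_simps)
    then have "norm (S y - T y) / norm y \<le> C + D"
      using False by (simp add: divide_simps)
    then show ?thesis by simp
  qed simp
  then show ?thesis by (auto intro!: bdd_aboveI2)
qed

lemma Metric_space_Emb:
  assumes "subspace Y"
  shows "Metric_space (Emb Y) (Emb_dist Y)"
proof
  have ne: "Y \<noteq> {}" using subspace_0[OF assms] by blast
  have upper: "norm (S y - T y) / norm y \<le> Emb_dist Y S T"
    if "S \<in> Emb Y" "T \<in> Emb Y" "y \<in> Y" for S T y
    unfolding Emb_dist_def using that cSUP_upper[OF \<open>y \<in> Y\<close> Emb_dist_bdd[OF that(1,2)]] by simp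
  have zero: "T 0 = 0" if "T \<in> Emb Y" for T
  proof -
    have "T (0 + 0) = T 0 + T 0"
      using that subspace_0[OF assms] unfolding Emb_def operators_def by blast
    then show ?thesis by simp
  qed
  show "0 \<le> Emb_dist Y S T" for S T
  proof (cases "S \<in> Emb Y \<and> T \<in> Emb Y")
    case True
    then show ?thesis using upper[of S T 0] subspace_0[OF assms] by simp
  qed (auto simp: Emb_dist_def)
  show "Emb_dist Y S T = Emb_dist Y T S" for S T
    unfolding Emb_dist_def by (simp add: norm_minus_commute conj_commute)
  show "Emb_dist Y S T = 0 \<longleftrightarrow> S = T" if "S \<in> Emb Y" "T \<in> Emb Y" for S T
  proof
    assume *: "Emb_dist Y S T = 0"
    show "S = T"
    proof (rule extensionalityI[of _ Y])
      show "S \<in> extensional Y" "T \<in> extensional Y"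
        using that unfolding Emb_def operators_def by (auto simp: PiE_def)
      show "S y = T y" if "y \<in> Y" for y
      proof (cases "y = 0")
        case True
        then show ?thesis using zero[OF \<open>S \<in> Emb Y\<close>] zero[OF \<open>T \<in> Emb Y\<close>] by simp
      next
        case False
        then show ?thesis
          using upper[OF \<open>S \<in> Emb Y\<close> \<open>T \<in> Emb Y\<close> that] * by (simp add: divide_simps split: if_splits)
      qed
    qed
  next
    assume "S = T"
    then show "Emb_dist Y S T = 0" using ne by (simp add: Emb_dist_def)
  qed
  show "Emb_dist Y R T \<le> Emb_dist Y R S + Emb_dist Y S T"
    if "R \<in> Emb Y" "S \<in> Emb Y" "T \<in> Emb Y" for R S T
  proof -
    have "norm (R y - T y) / norm y \<le> Emb_dist Y R S + Emb_dist Y S T" if "y \<in> Y" for y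
    proof -
      have "norm (R y - T y) / norm y \<le> (norm (R y - S y) + norm (S y - T y)) / norm y"
        using norm_triangle_ineq[of "R y - S y" "S y - T y"] by (intro divide_right_mono) auto
      also have "\<dots> \<le> Emb_dist Y R S + Emb_dist Y S T"
        unfolding add_divide_distrib
        using upper \<open>R \<in> Emb Y\<close> \<open>S \<in> Emb Y\<close> \<open>T \<in> Emb Y\<close> that by (intro add_mono) auto
      finally show ?thesis .
    qed
    then show ?thesis
      using ne that(1,3) by (subst (1) Emb_dist_def) (auto intro: cSUP_least)
  qed
qed

end

lemma banach_space_real: "banach_space (scaleR :: real \<Rightarrow> 'a::banach \<Rightarrow> 'a)"
  by unfold_locales (auto simp: algebra_simps)

lemma banach_space_complex: "banach_space ((*) :: complex \<Rightarrow> complex \<Rightarrow> complex)"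
  by unfold_locales (auto simp: algebra_simps norm_mult scaleR_conv_of_real)

end

theory Submission
  imports Defs
begin

text \<open>
  Hahn-Banach provides bounded functionals of norm one, both over the reals and over the complex
  numbers; the argument then does not depend on the field. If an operator \<open>S\<close> on \<open>Y\<close> is not bounded
  below on any subspace \<open>Y \<inter> ker f\<^sub>1 \<inter> \<dots> \<inter> ker f\<^sub>n\<close>, it is arbitrarily small on some
  infinite-dimensional closed subspace of \<open>Y\<close>. For an embedding \<open>T\<close> of \<open>Y\<close> with image \<open>Z\<close> this can
  happen for \<open>T - \<lambda> i\<close> with at most one scalar \<open>\<lambda>\<close>, as otherwise two of these subspaces would form a
  topological direct sum. So, after changing the sign of \<open>T\<close>, the segment from \<open>i\<close> to \<open>T\<close> avoids this
  behaviour, and by compactness all of it is uniformly bounded below on one subspace of finite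
  codimension. This path of embeddings of a finite-codimensional subspace is extended to \<open>Y\<close> one
  dimension at a time. When a vector \<open>e\<close> is added, its image is moved off the image of the old
  subspace along the path; at the end of the path a segment takes it to \<open>T e\<close> or to
  \<open>- T e\<close>, and both choices give the same image as \<open>T\<close>.
\<close>

subsection \<open>Norming functionals\<close>

text \<open>Homogeneity is asked for as an inequality only: rescaling by \<open>1 / t\<close> gives
  the converse for positive \<open>t\<close>, and \<open>t = 0\<close> gives
  \<open>p 0 \<le> 0\<close>.\<close>

definition sublinear :: "('a::real_vector \<Rightarrow> real) \<Rightarrow> bool" where
  "sublinear p \<longleftrightarrow> (\<forall>x y. p (x + y) \<le> p x + p y) \<and> (\<forall>t\<ge>0. \<forall>x. p (t *\<^sub>R x) \<le> t * p x)"

lemma sublinear_add: "sublinear p \<Longrightarrow> p (x + y) \<le> p x + p y"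
  and sublinear_scale: "sublinear p \<Longrightarrow> 0 \<le> t \<Longrightarrow> p (t *\<^sub>R x) \<le> t * p x"
  by (simp_all add: sublinear_def)

lemma sublinear_minus: "sublinear p \<Longrightarrow> - p (- x) \<le> p x"
  using sublinear_add[of p x "-x"] sublinear_add[of p 0 0] by simp

text \<open>The functional \<open>q\<close> lies below \<open>p\<close> (parameter 0) and is pushed
  down in the direction \<open>- y\<close>: parameter 1 bounds \<open>q (- y)\<close> by
  \<open>p 0 - p y\<close>. The infimum is finite since sublinearity bounds every term from below by
  \<open>- p (- x)\<close>.\<close>

lemma sublinear_shift:
  fixes p :: "'a::real_vector \<Rightarrow> real" and y :: 'a
  assumes "sublinear p"
  defines "q \<equiv> \<lambda>x. INF t\<in>{0..}. p (x + t *\<^sub>R y) - t * p y"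
  shows "sublinear q" and "\<And>t. 0 \<le> t \<Longrightarrow> q x \<le> p (x + t *\<^sub>R y) - t * p y"
proof -
  have "- p (- x) \<le> p (x + t *\<^sub>R y) - t * p y" if "0 \<le> t" for x t
  proof -
    have "t * p y \<le> p (t *\<^sub>R y)"
      using sublinear_scale[OF assms(1), of "1 / t" "t *\<^sub>R y"] sublinear_minus[OF assms(1), of 0] that
      by (cases "t = 0") (simp_all add: pos_le_divide_eq mult.commute)
    then show ?thesis
      using sublinear_add[OF assms(1), of "x + t *\<^sub>R y" "- x"] by simp
  qed
  then have bdd: "bdd_below ((\<lambda>t. p (x + t *\<^sub>R y) - t * p y) ` {0..})" for x
    by (auto intro!: bdd_belowI2)
  show upper: "\<And>t. 0 \<le> t \<Longrightarrow> q x \<le> p (x + t *\<^sub>R y) - t * p y" for x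
    unfolding q_def by (rule cINF_lower[OF bdd]) simp
  have lower: "m \<le> q x" if "\<And>t. 0 \<le> t \<Longrightarrow> m \<le> p (x + t *\<^sub>R y) - t * p y" for m x
    unfolding q_def using that by (intro cINF_greatest) auto
  show "sublinear q"
    unfolding sublinear_def
  proof safe
    fix x x'
    \<comment> \<open>The parameters \<open>t\<close> for \<open>x\<close> and \<open>s\<close> for
      \<open>x'\<close> combine to \<open>t + s\<close> for the sum, so the infimum can be taken
      over each of them separately.\<close>
    have "q (x + x') - (p (x + t *\<^sub>R y) - t * p y) \<le> p (x' + s *\<^sub>R y) - s * p y" if "0 \<le> t" "0 \<le> s" for s t
      using upper[of "t + s" "x + x'"] sublinear_add[OF assms(1), of "x + t *\<^sub>R y" "x' + s *\<^sub>R y"] that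
      by (simp add: algebra_simps)
    then have "q (x + x') - (p (x + t *\<^sub>R y) - t * p y) \<le> q x'" if "0 \<le> t" for t
      using that by (intro lower)
    then have "q (x + x') - q x' \<le> q x"
      by (intro lower) (simp add: algebra_simps)
    then show "q (x + x') \<le> q x + q x'" by simp
  next
    fix r x assume r: "0 \<le> (r::real)"
    show "q (r *\<^sub>R x) \<le> r * q x"
    proof (cases "r = 0")
      case True
      then show ?thesis using upper[of 0 0] sublinear_scale[OF assms(1), of 0 0] by simp
    next
      case False
      have "q (r *\<^sub>R x) / r \<le> q x"
      proof (rule lower)
        fix t :: real assume "0 \<le> t"
        then have "q (r *\<^sub>R x) \<le> r * p (x + t *\<^sub>R y) - r * t * p y"
          using upper[of "r * t" "r *\<^sub>R x"] sublinear_scale[OF assms(1) r, of "x + t *\<^sub>R y"] r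
          by (simp add: algebra_simps)
        then show "q (r *\<^sub>R x) / r \<le> p (x + t *\<^sub>R y) - t * p y"
          using r False by (simp add: field_simps)
      qed
      then show ?thesis using r False by (simp add: field_simps)
    qed
  qed
qed

text \<open>Subadditivity compares two members of \<open>C\<close> at two different points; the
  chain condition supplies one member below both. The minorant \<open>b\<close> keeps the infima
  finite.\<close>

lemma sublinear_Inf_chain:
  assumes "C \<noteq> {}" and sub: "\<And>p. p \<in> C \<Longrightarrow> sublinear p"
    and below: "\<And>p x. p \<in> C \<Longrightarrow> b x \<le> p x"
    and chain: "\<And>p q. p \<in> C \<Longrightarrow> q \<in> C \<Longrightarrow> p \<le> q \<or> q \<le> p"
  shows "sublinear (\<lambda>x. INF p\<in>C. p x)"
    and "\<And>p. p \<in> C \<Longrightarrow> (\<lambda>x. INF p\<in>C. p x) \<le> p"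
proof -
  let ?q = "\<lambda>x. INF p\<in>C. p x"
  have upper: "?q x \<le> p x" if "p \<in> C" for p x
    using that below by (intro cINF_lower bdd_belowI2) auto
  have lower: "m \<le> ?q x" if "\<And>p. p \<in> C \<Longrightarrow> m \<le> p x" for m x
    using that \<open>C \<noteq> {}\<close> by (intro cINF_greatest) auto
  show "\<And>p. p \<in> C \<Longrightarrow> ?q \<le> p" by (simp add: le_fun_def upper)
  show "sublinear ?q"
    unfolding sublinear_def
  proof safe
    fix x y
    have "?q (x + y) - p x \<le> p' y" if pp: "p \<in> C" "p' \<in> C" for p p'
    proof -
      obtain r where r: "r \<in> C" "r \<le> p" "r \<le> p'" using chain[OF pp] pp by blast
      have "?q (x + y) \<le> r (x + y)" using upper r by simp
      also have "\<dots> \<le> r x + r y" using sublinear_add sub r by blast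
      also have "\<dots> \<le> p x + p' y" using r by (intro add_mono) (auto simp: le_fun_def)
      finally show ?thesis by simp
    qed
    then have "?q (x + y) - p x \<le> ?q y" if "p \<in> C" for p using that by (intro lower)
    then have "?q (x + y) - ?q y \<le> ?q x" by (intro lower) (simp add: algebra_simps)
    then show "?q (x + y) \<le> ?q x + ?q y" by simp
  next
    fix t x assume t: "0 \<le> (t::real)"
    have *: "?q (t *\<^sub>R x) \<le> t * p x" if "p \<in> C" for p
      using upper[OF that, of "t *\<^sub>R x"] sublinear_scale[OF sub[OF that] t, of x] by linarith
    show "?q (t *\<^sub>R x) \<le> t * ?q x"
    proof (cases "t = 0")
      case True
      then show ?thesis using * \<open>C \<noteq> {}\<close> by force
    next
      case False
      then have "?q (t *\<^sub>R x) / t \<le> ?q x" using * t by (intro lower) (simp add: field_simps)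
      then show ?thesis using False t by (simp add: field_simps)
    qed
  qed
qed

text \<open>The functional of \<open>sublinear_shift\<close> cannot be strictly smaller than
  \<open>p\<close>, and its bound at parameter 1 then reverses the subadditivity of
  \<open>p\<close>.\<close>

lemma minimal_sublinear_linear:
  assumes "sublinear p" and min: "\<And>q. sublinear q \<Longrightarrow> q \<le> p \<Longrightarrow> q = p"
  shows "linear p"
proof -
  have ge: "p x + p y \<le> p (x + y)" for x y
  proof -
    let ?q = "\<lambda>x. INF t\<in>{0..}. p (x + t *\<^sub>R y) - t * p y"
    have "?q \<le> p" using sublinear_shift(2)[OF assms(1), of 0 _ y] by (simp add: le_fun_def)
    then have "?q = p" by (rule min[OF sublinear_shift(1)[OF assms(1)]])
    then have "?q x = p x" by (rule fun_cong)
    then show ?thesis using sublinear_shift(2)[OF assms(1), of 1 x y] by simp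
  qed
  have add: "p (x + y) = p x + p y" for x y
    using ge sublinear_add[OF assms(1)] by (intro antisym)
  have zero: "p 0 = 0" using add[of 0 0] by simp
  have neg: "p (- x) = - p x" for x using add[of x "- x"] zero by simp
  \<comment> \<open>Since \<open>p\<close> is odd, the inequality at \<open>x\<close> and at
    \<open>- x\<close> gives equality.\<close>
  have scale: "p (t *\<^sub>R x) = t * p x" if "0 \<le> t" for t x
    using sublinear_scale[OF assms(1) that, of x] sublinear_scale[OF assms(1) that, of "- x"]
    by (simp add: neg)
  have "p (t *\<^sub>R x) = t * p x" for t x
    using scale[of t x] scale[of "- t" x] neg[of "t *\<^sub>R x"] by (cases "0 \<le> t") auto
  then show ?thesis using add by (intro linearI) auto
qed

text \<open>Zorn's lemma provides a minimal sublinear functional below \<open>p\<close>. All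
  sublinear functionals below \<open>p\<close> lie above \<open>- p (- x)\<close>, so chains have
  infima.\<close>

lemma exists_linear_le_sublinear:
  assumes "sublinear p"
  obtains f where "linear f" "f \<le> p"
proof -
  define A where "A = {q. sublinear q \<and> q \<le> p}"
  \<comment> \<open>The order is reversed because Zorn's lemma is applied in the form that yields
    maximal elements.\<close>
  let ?R = "relation_of (\<lambda>q r. r \<le> q) A"
  have "\<exists>m\<in>A. \<forall>q\<in>A. q \<le> m \<longrightarrow> q = m"
  proof (rule predicate_Zorn)
    show "partial_order_on A ?R"
      by (rule partial_order_on_relation_ofI) auto
    fix C assume C: "C \<in> Chains ?R"
    then have CA: "C \<subseteq> A" by (auto simp: Chains_def relation_of_def)
    have below: "- p (- x) \<le> q x" if "q \<in> C" for q x
    proof -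
      have "q (- x) \<le> p (- x)" "sublinear q" using that CA by (auto simp: A_def le_fun_def)
      then show ?thesis using sublinear_minus[of q x] by simp
    qed
    show "\<exists>u\<in>A. \<forall>q\<in>C. u \<le> q"
    proof (cases "C = {}")
      case True
      then show ?thesis using assms by (auto simp: A_def)
    next
      case False
      let ?q = "\<lambda>x. INF q\<in>C. q x"
      have chain: "q \<le> r \<or> r \<le> q" if "q \<in> C" "r \<in> C" for q r
        using that C by (auto simp: Chains_def relation_of_def)
      have sub: "sublinear q" if "q \<in> C" for q
        using that CA by (auto simp: A_def)
      note * = sublinear_Inf_chain[where C = C and b = "\<lambda>x. - p (- x)", OF False]
      have q: "sublinear ?q" by (rule *(1)) (use sub below chain in auto)
      have "?q \<le> q" if "q \<in> C" for q by (rule *(2)) (use sub below chain that in auto)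
      note q = q this
      obtain r where "r \<in> C" using False by blast
      then have "?q \<le> r" "r \<le> p" using q CA by (auto simp: A_def)
      then have "?q \<le> p" by (rule order_trans)
      then show ?thesis using q unfolding A_def by blast
    qed
  qed
  then obtain m where m: "m \<in> A" "\<And>q. q \<in> A \<Longrightarrow> q \<le> m \<Longrightarrow> q = m" by blast
  have "linear m"
  proof (rule minimal_sublinear_linear)
    show "sublinear m" using m by (simp add: A_def)
    show "q = m" if "sublinear q" "q \<le> m" for q
      using that m(1) by (intro m(2)) (auto simp: A_def intro: order_trans)
  qed
  then show thesis using m(1) that by (simp add: A_def)
qed

text \<open>A linear functional below the shift of the norm by \<open>w\<close> is at most the norm
  (parameter 0), and its value at \<open>- w\<close> is at most \<open>- norm w\<close> (parameter
  1).\<close>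

lemma real_norming_functional:
  fixes w :: "'a::real_normed_vector"
  obtains f where "linear f" "\<And>x. \<bar>f x\<bar> \<le> norm x" "f w = norm w"
proof -
  have sub: "sublinear (norm :: 'a \<Rightarrow> real)"
    by (simp add: sublinear_def norm_triangle_ineq)
  note q = sublinear_shift[where y = w, OF sub]
  obtain f where f: "linear f" "f \<le> (\<lambda>x. INF t\<in>{0..}. norm (x + t *\<^sub>R w) - t * norm w)"
    using exists_linear_le_sublinear[OF q(1)] by blast
  have le: "f x \<le> norm (x + t *\<^sub>R w) - t * norm w" if "0 \<le> t" for x t
    using f(2) q(2)[OF that, of x] unfolding le_fun_def by (meson order_trans)
  have neg: "f (- x) = - f x" for x using f(1) by (rule linear_neg)
  have abs: "\<bar>f x\<bar> \<le> norm x" for x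
    using le[of 0 x] le[of 0 "- x"] by (simp add: neg)
  have "f w = norm w" using le[of 1 "- w"] abs[of w] by (simp add: neg)
  then show thesis using that f(1) abs by blast
qed

subsection \<open>Operators on subspaces\<close>

text \<open>Norming functionals are the point where the choice of scalars matters; assuming them
  lets one argument cover the real and the complex case.\<close>

locale hahn_banach_space = banach_space scale
  for scale :: "'k::real_normed_field \<Rightarrow> 'a::banach \<Rightarrow> 'a"  (infixr "*\<^sub>K" 75) +
  assumes norming_functional: "\<exists>f. (\<forall>x y. f (x + y) = f x + f y) \<and>
    (\<forall>c x. f (c *\<^sub>K x) = c * f x) \<and> (\<forall>x. norm (f x) \<le> norm x) \<and> f w = of_real (norm w)"

context banach_space
begin

lemma scaleR_eq_scale: "r *\<^sub>R x = of_real r *\<^sub>K x"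
  by (simp add: scale_of_real)

lemma scale_scaleR: "c *\<^sub>K r *\<^sub>R x = r *\<^sub>R c *\<^sub>K x"
  by (simp add: scaleR_eq_scale scale_left_commute)

lemma subspace_scaleR: "subspace Y \<Longrightarrow> x \<in> Y \<Longrightarrow> r *\<^sub>R x \<in> Y"
  by (simp add: scaleR_eq_scale subspace_scale)

lemma bounded_linear_scale: "bounded_linear (\<lambda>x. c *\<^sub>K x)"
  by (rule bounded_linear_intro[where K = "norm c"])
    (auto simp: scale_right_distrib scale_scaleR norm_scale mult.commute)

lemma subspace_closure:
  assumes "subspace Y"
  shows "subspace (closure Y)"
  unfolding subspace_def
proof (intro conjI ballI allI)
  show "0 \<in> closure Y" using subspace_0[OF assms] closure_subset by blast
  show "x + y \<in> closure Y" if xy: "x \<in> closure Y" "y \<in> closure Y" for x y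
  proof -
    obtain u v where "\<forall>n. u n \<in> Y" "u \<longlonglongrightarrow> x" "\<forall>n. v n \<in> Y" "v \<longlonglongrightarrow> y"
      using xy unfolding closure_sequential by blast
    then show ?thesis
      unfolding closure_sequential
      by (intro exI[of _ "\<lambda>n. u n + v n"]) (auto intro: subspace_add[OF assms] tendsto_add)
  qed
  show "c *\<^sub>K x \<in> closure Y" if x: "x \<in> closure Y" for c x
  proof -
    obtain u where "\<forall>n. u n \<in> Y" "u \<longlonglongrightarrow> x"
      using x unfolding closure_sequential by blast
    then show ?thesis
      unfolding closure_sequential
      by (intro exI[of _ "\<lambda>n. c *\<^sub>K u n"])
        (auto intro: subspace_scale[OF assms] bounded_linear.tendsto[OF bounded_linear_scale])
  qed
qed

lemma operators_add: "T \<in> operators Y W \<Longrightarrow> x \<in> Y \<Longrightarrow> y \<in> Y \<Longrightarrow> T (x + y) = T x + T y"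
  and operators_scale: "T \<in> operators Y W \<Longrightarrow> y \<in> Y \<Longrightarrow> T (c *\<^sub>K y) = c *\<^sub>K T y"
  and operators_extensional: "T \<in> operators Y W \<Longrightarrow> T \<in> extensional Y"
  by (auto simp: operators_def PiE_def)

lemma operators_scaleR: "T \<in> operators Y W \<Longrightarrow> y \<in> Y \<Longrightarrow> T (r *\<^sub>R y) = r *\<^sub>R T y"
  by (simp add: scaleR_eq_scale operators_scale)

lemma operators_diff:
  assumes "subspace Y" "T \<in> operators Y W" "x \<in> Y" "y \<in> Y"
  shows "T (x - y) = T x - T y"
  using operators_add[OF assms(2), of "x - y" y] assms(3,4) subspace_diff[OF assms(1)] by simp

lemma operators_0: "subspace Y \<Longrightarrow> T \<in> operators Y W \<Longrightarrow> T 0 = 0"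
  using operators_diff[of Y T W 0 0] subspace_0 by auto

lemma operators_sum:
  assumes "subspace Y" "T \<in> operators Y W" "\<And>k. k \<in> I \<Longrightarrow> w k \<in> Y"
  shows "T (\<Sum>k\<in>I. a k *\<^sub>K w k) = (\<Sum>k\<in>I. a k *\<^sub>K T (w k))"
  using assms(3)
proof (induction I rule: infinite_finite_induct)
  case (insert k I)
  then have "a k *\<^sub>K w k \<in> Y" "(\<Sum>k\<in>I. a k *\<^sub>K w k) \<in> Y"
    by (auto intro!: subspace_sum subspace_scale assms(1))
  then show ?case
    using insert by (simp add: operators_add[OF assms(2)] operators_scale[OF assms(2)])
qed (auto simp: operators_0[OF assms(1,2)])

lemma operators_bound:
  assumes "T \<in> operators Y W"
  obtains C where "0 < C" "\<And>y. y \<in> Y \<Longrightarrow> norm (T y) \<le> C * norm y"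
proof -
  obtain C where C: "\<And>y. y \<in> Y \<Longrightarrow> norm (T y) \<le> C * norm y"
    using assms unfolding operators_def by blast
  have "norm (T y) \<le> max 1 C * norm y" if "y \<in> Y" for y
    using C[OF that] mult_right_mono[of C "max 1 C" "norm y"] by simp
  then show thesis using that[of "max 1 C"] by simp
qed

lemma operatorsI:
  assumes "\<And>x y. x \<in> Y \<Longrightarrow> y \<in> Y \<Longrightarrow> x + y \<in> Y \<Longrightarrow> T (x + y) = T x + T y"
    and "\<And>c y. y \<in> Y \<Longrightarrow> c *\<^sub>K y \<in> Y \<Longrightarrow> T (c *\<^sub>K y) = c *\<^sub>K T y"
    and "\<And>y. y \<in> Y \<Longrightarrow> norm (T y) \<le> C * norm y"
    and "subspace Y"
  shows "restrict T Y \<in> operators Y UNIV"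
  using assms unfolding operators_def by (auto simp: subspace_add subspace_scale intro!: exI[of _ C])

lemma operators_lincomb:
  assumes Y: "subspace Y" and "A \<in> operators Y W" "B \<in> operators Y W'"
  shows "(\<lambda>y\<in>Y. r *\<^sub>R A y + s *\<^sub>R B y) \<in> operators Y UNIV"
proof -
  obtain a b where a: "\<And>y. y \<in> Y \<Longrightarrow> norm (A y) \<le> a * norm y"
    and b: "\<And>y. y \<in> Y \<Longrightarrow> norm (B y) \<le> b * norm y"
    using operators_bound[OF assms(2)] operators_bound[OF assms(3)] by metis
  show ?thesis
  proof (rule operatorsI[OF _ _ _ Y])
    fix y assume y: "y \<in> Y"
    have "norm (r *\<^sub>R A y + s *\<^sub>R B y) \<le> \<bar>r\<bar> * norm (A y) + \<bar>s\<bar> * norm (B y)"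
      using norm_triangle_ineq[of "r *\<^sub>R A y" "s *\<^sub>R B y"] by simp
    also have "\<dots> \<le> \<bar>r\<bar> * (a * norm y) + \<bar>s\<bar> * (b * norm y)"
      using a[OF y] b[OF y] by (intro add_mono mult_left_mono) auto
    finally show "norm (r *\<^sub>R A y + s *\<^sub>R B y) \<le> (\<bar>r\<bar> * a + \<bar>s\<bar> * b) * norm y"
      by (simp add: algebra_simps)
    show "r *\<^sub>R A (c *\<^sub>K y) + s *\<^sub>R B (c *\<^sub>K y) = c *\<^sub>K (r *\<^sub>R A y + s *\<^sub>R B y)" for c
      using y by (simp add: operators_scale[OF assms(2)] operators_scale[OF assms(3)]
          scale_right_distrib scale_scaleR)
  qed (simp add: operators_add[OF assms(2)] operators_add[OF assms(3)] algebra_simps)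
qed

lemma operators_restrict:
  assumes "T \<in> operators Y W" "subspace V" "V \<subseteq> Y"
  shows "restrict T V \<in> operators V UNIV"
proof -
  obtain C where "\<And>y. y \<in> Y \<Longrightarrow> norm (T y) \<le> C * norm y"
    using operators_bound[OF assms(1)] by metis
  then show ?thesis
    using assms by (intro operatorsI[where C = C]) (auto intro: operators_add operators_scale)
qed

lemma EmbI:
  assumes "T \<in> operators Y UNIV" "0 < c" "\<And>y. y \<in> Y \<Longrightarrow> c * norm y \<le> norm (T y)"
  shows "T \<in> Emb Y"
  using assms by (auto simp: Emb_def)

lemma Emb_operators: "T \<in> Emb Y \<Longrightarrow> T \<in> operators Y UNIV"
  by (simp add: Emb_def)

lemma Emb_lower:
  assumes "T \<in> Emb Y"
  obtains c where "0 < c" "\<And>y. y \<in> Y \<Longrightarrow> c * norm y \<le> norm (T y)"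
  using assms by (auto simp: Emb_def)

lemma Emb_restrict:
  assumes "T \<in> Emb Y" "subspace V" "V \<subseteq> Y"
  shows "restrict T V \<in> Emb V"
proof -
  obtain c where "0 < c" "\<And>y. y \<in> Y \<Longrightarrow> c * norm y \<le> norm (T y)"
    using Emb_lower[OF assms(1)] by blast
  then show ?thesis
    using assms(3)
    by (intro EmbI[of _ _ c] operators_restrict[OF Emb_operators[OF assms(1)] assms(2,3)]) auto
qed

definition dual_ball :: "('a \<Rightarrow> 'k) set" where
  "dual_ball = {f. (\<forall>x y. f (x + y) = f x + f y) \<and> (\<forall>c x. f (c *\<^sub>K x) = c * f x) \<and>
    (\<forall>x. norm (f x) \<le> norm x)}"

lemma dual_ball_add: "f \<in> dual_ball \<Longrightarrow> f (x + y) = f x + f y"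
  and dual_ball_scale: "f \<in> dual_ball \<Longrightarrow> f (c *\<^sub>K x) = c * f x"
  and dual_ball_norm: "f \<in> dual_ball \<Longrightarrow> norm (f x) \<le> norm x"
  by (auto simp: dual_ball_def)

lemma dual_ball_0: "f \<in> dual_ball \<Longrightarrow> f 0 = 0"
  using dual_ball_norm[of f 0] by simp

lemma dual_ball_diff: "f \<in> dual_ball \<Longrightarrow> f (x - y) = f x - f y"
  using dual_ball_add[of f "x - y" y] by simp

lemma dual_ball_sum: "f \<in> dual_ball \<Longrightarrow> f (\<Sum>k\<in>I. a k *\<^sub>K w k) = (\<Sum>k\<in>I. a k * f (w k))"
  by (induction I rule: infinite_finite_induct)
    (auto simp: dual_ball_0 dual_ball_add dual_ball_scale)

lemma subspace_kernel:
  assumes "subspace Y" "f \<in> dual_ball"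
  shows "subspace {y \<in> Y. f y = 0}"
  using assms
  by (auto simp: subspace_def dual_ball_0 dual_ball_add dual_ball_scale)

text \<open>Applied to differences, the estimate makes the inverse of addition Lipschitz. Applied to
  \<open>x\<close> and \<open>- x\<close>, it gives the trivial intersection.\<close>

lemma topological_direct_sumI:
  assumes A: "subspace A" and B: "subspace B"
    and M: "\<And>a b. a \<in> A \<Longrightarrow> b \<in> B \<Longrightarrow> norm a + norm b \<le> M * norm (a + b)"
  shows "topological_direct_sum A B"
proof -
  define S where "S = {a + b | a b. a \<in> A \<and> b \<in> B}"
  let ?h = "\<lambda>(a, b). a + b"
  have dist: "norm (p - q) \<le> M * norm (?h p - ?h q)" if "p \<in> A \<times> B" "q \<in> A \<times> B" for p q
  proof -
    obtain a b a' b' where pq: "p = (a, b)" "q = (a', b')" "a \<in> A" "a' \<in> A" "b \<in> B" "b' \<in> B"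
      using \<open>p \<in> A \<times> B\<close> \<open>q \<in> A \<times> B\<close> by auto
    have "norm (p - q) \<le> norm (a - a') + norm (b - b')"
      by (simp add: pq norm_Pair_le)
    also have "\<dots> \<le> M * norm ((a - a') + (b - b'))"
      using pq by (intro M subspace_diff A B)
    also have "(a - a') + (b - b') = ?h p - ?h q" by (simp add: pq)
    finally show ?thesis .
  qed
  have inj: "inj_on ?h (A \<times> B)"
  proof (rule inj_onI)
    fix p q assume "p \<in> A \<times> B" "q \<in> A \<times> B" "?h p = ?h q"
    then show "p = q" using dist[of p q] by simp
  qed
  have image: "?h ` (A \<times> B) = S" by (auto simp: S_def)
  define g where "g = the_inv_into (A \<times> B) ?h"
  have gh: "g (?h p) = p" if "p \<in> A \<times> B" for p
    unfolding g_def using inj that by (rule the_inv_into_f_f)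
  have "continuous_on S g"
  proof (rule lipschitz_on_continuous_on)
    show "(max 0 M)-lipschitz_on S g"
    proof (rule lipschitz_onI)
      fix x y assume "x \<in> S" "y \<in> S"
      then obtain p q where pq: "p \<in> A \<times> B" "q \<in> A \<times> B" "x = ?h p" "y = ?h q"
        unfolding image[symmetric] by blast
      have "norm (p - q) \<le> max 0 M * norm (?h p - ?h q)"
        by (rule order_trans[OF dist[OF pq(1,2)]]) (intro mult_right_mono, auto)
      then show "dist (g x) (g y) \<le> max 0 M * dist x y"
        using pq gh by (simp add: dist_norm)
    qed simp
  qed
  moreover have "continuous_on (A \<times> B) ?h"
    by (auto simp: case_prod_unfold intro!: continuous_intros)
  ultimately have "homeomorphism (A \<times> B) S ?h g"
    using image gh by (intro homeomorphismI) auto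
  moreover have "A \<inter> B = {0}"
  proof -
    have "x = 0" if "x \<in> A" "x \<in> B" for x
      using M[OF that(1) subspace_neg[OF B that(2)]] by simp
    then show ?thesis using subspace_0[OF A] subspace_0[OF B] by blast
  qed
  ultimately show ?thesis
    unfolding topological_direct_sum_def S_def by blast
qed

end

subsection \<open>Singular operators on hereditarily indecomposable spaces\<close>

context banach_space
begin

text \<open>The usual notion is an into isomorphism after restriction to some subspace of finite
  codimension. With functionals in place of the codimension, a failure directly provides vectors
  killed by any prescribed finite family.\<close>

definition finitely_singular :: "'a set \<Rightarrow> ('a \<Rightarrow> 'a) \<Rightarrow> bool" where
  "finitely_singular Y S \<longleftrightarrow> (\<exists>\<Phi> c. finite \<Phi> \<and> \<Phi> \<subseteq> dual_ball \<and> 0 < c \<and>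
    (\<forall>y\<in>Y. (\<forall>f\<in>\<Phi>. f y = 0) \<longrightarrow> c * norm y \<le> norm (S y)))"

section \<open>Triangular systems of vectors and functionals\<close>

lemma span_range_sum:
  fixes w :: "nat \<Rightarrow> 'a"
  assumes "x \<in> span (range w)"
  obtains n a where "x = (\<Sum>k<n. a k *\<^sub>K w k)"
proof -
  have "\<exists>n a. x = (\<Sum>k<n. a k *\<^sub>K w k)"
    using assms
  proof (induction rule: span_induct_alt)
    case base
    show ?case by (rule exI[of _ 0]) simp
  next
    case (step c v y)
    then obtain m n a where m: "v = w m" and y: "y = (\<Sum>k<n. a k *\<^sub>K w k)" by blast
    \<comment> \<open>Both summands are padded with zero coefficients to a common length that
      exceeds \<open>m\<close>.\<close>
    let ?N = "max n (Suc m)"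
    have "(\<Sum>k<?N. (if k < n then a k else 0) *\<^sub>K w k) = y"
      unfolding y by (rule sum.mono_neutral_cong_right) auto
    moreover have "(\<Sum>k<?N. (if k = m then c else 0) *\<^sub>K w k) = c *\<^sub>K v"
      using sum.mono_neutral_right[of "{..<?N}" "{m}" "\<lambda>k. (if k = m then c else 0) *\<^sub>K w k"] m
      by auto
    ultimately have "c *\<^sub>K v + y =
        (\<Sum>k<?N. ((if k = m then c else 0) + (if k < n then a k else 0)) *\<^sub>K w k)"
      by (simp only: scale_left_distrib sum.distrib)
    then show ?case by (intro exI)
  qed
  then show thesis using that by blast
qed

context
  fixes w :: "nat \<Rightarrow> 'a" and g :: "nat \<Rightarrow> 'a \<Rightarrow> 'k"
  assumes g: "\<And>n. g n \<in> dual_ball" and g_w: "\<And>n. g n (w n) = 1"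
    and g_later: "\<And>j n. j < n \<Longrightarrow> g j (w n) = 0"
begin

text \<open>Applying \<open>g k\<close> kills all terms after \<open>k\<close>, so
  \<open>a k\<close> is bounded by the norm of the sum plus the earlier coefficients. The bounds add
  up as 1 + (1 + 2 + ... + 2^(k-1)) = 2^k.\<close>

lemma triangular_coeff_bound:
  assumes norm_w: "\<And>n. norm (w n) = 1"
  shows "k < n \<Longrightarrow> norm (a k) \<le> 2 ^ k * norm (\<Sum>j<n. a j *\<^sub>K w j)"
proof (induction k rule: less_induct)
  case (less k)
  let ?x = "\<Sum>j<n. a j *\<^sub>K w j"
  have "g k ?x = (\<Sum>j<n. a j * g k (w j))" by (rule dual_ball_sum[OF g])
  also have "\<dots> = (\<Sum>j<Suc k. a j * g k (w j))"
    using less.prems g_later by (intro sum.mono_neutral_right) auto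
  also have "\<dots> = (\<Sum>j<k. a j * g k (w j)) + a k" by (simp add: g_w)
  finally have "norm (a k) \<le> norm (g k ?x) + norm (\<Sum>j<k. a j * g k (w j))"
    using norm_triangle_ineq4[of "g k ?x" "\<Sum>j<k. a j * g k (w j)"] by simp
  also have "norm (\<Sum>j<k. a j * g k (w j)) \<le> (\<Sum>j<k. 2 ^ j * norm ?x)"
  proof (rule sum_norm_le)
    fix j assume j: "j \<in> {..<k}"
    have "norm (a j * g k (w j)) \<le> norm (a j)"
      using dual_ball_norm[OF g, of k "w j"]
      by (simp add: norm_w norm_mult mult_left_le)
    also have "\<dots> \<le> 2 ^ j * norm ?x" using less j by auto
    finally show "norm (a j * g k (w j)) \<le> 2 ^ j * norm ?x" .
  qed
  also have "(\<Sum>j<k. 2 ^ j * norm ?x) = (2 ^ k - 1) * norm ?x"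
    by (simp add: geometric_sum flip: sum_distrib_right)
  finally show ?case using dual_ball_norm[OF g, of k ?x] by (simp add: algebra_simps)
qed

text \<open>The functional \<open>g k\<close> kills the span of all later vectors but not
  \<open>w k\<close>. The induction therefore adds vectors at the front, which is why the starting
  index is arbitrary.\<close>

lemma triangular_independent:
  "independent (w ` {k..<k + m}) \<and> card (w ` {k..<k + m}) = m"
proof (induction m arbitrary: k)
  case 0
  then show ?case by (simp add: independent_empty)
next
  case (Suc m)
  let ?I = "{Suc k..<Suc k + m}"
  have "{k..<k + Suc m} = insert k ?I" by auto
  then have eq: "w ` {k..<k + Suc m} = insert (w k) (w ` ?I)" by simp
  have "span (w ` ?I) \<subseteq> {y. g k y = 0}"
    using subspace_kernel[OF subspace_UNIV g, of k] g_later
    by (intro span_minimal) auto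
  then have w: "w k \<notin> span (w ` ?I)" using g_w[of k] by auto
  then have "w k \<notin> w ` ?I" by (meson span_base)
  then show ?case
    unfolding eq using independent_insertI[OF w] Suc[of "Suc k"] by simp
qed

lemma triangular_not_finite_span:
  assumes "range w \<subseteq> W" "finite B"
  shows "span B \<noteq> W"
proof
  assume "span B = W"
  then have "w ` {0..<0 + Suc (card B)} \<subseteq> span B" using assms(1) by blast
  with triangular_independent[of 0 "Suc (card B)"] independent_span_bound[OF assms(2)]
  show False by fastforce
qed

end

end

section \<open>Infinitely singular operators and the segment from the inclusion to an
  embedding\<close>

context hahn_banach_space
begin

lemma dual_ball_norming:
  obtains f where "f \<in> dual_ball" "f w = of_real (norm w)"
  using norming_functional[of w] unfolding dual_ball_def by blast

text \<open>At stage \<open>n\<close> the failure of finite singularity is applied to the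
  functionals chosen so far with the constant \<open>\<epsilon> n\<close>. The resulting vector is
  normalised and a norming functional for it is added.\<close>

lemma infinitely_singular_sequence:
  assumes Y: "subspace Y" and T: "S \<in> operators Y UNIV"
    and sing: "\<not> finitely_singular Y S"
    and eps: "\<And>n. 0 < (\<epsilon> n :: real)"
  obtains w g where "\<And>n. w n \<in> Y" "\<And>n. norm (w n) = 1" "\<And>n. norm (S (w n)) \<le> \<epsilon> n"
    "\<And>n. g n \<in> dual_ball" "\<And>n. g n (w n) = 1" "\<And>j n::nat. j < n \<Longrightarrow> g j (w n) = 0"
proof -
  define P where "P h n r \<longleftrightarrow> fst r \<in> Y \<and> norm (fst r) = 1 \<and> norm (S (fst r)) \<le> \<epsilon> n \<and>
    snd r \<in> dual_ball \<and> snd r (fst r) = 1 \<and> (\<forall>j<n. snd (h j) (fst r) = 0)"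
    for h :: "nat \<Rightarrow> 'a \<times> ('a \<Rightarrow> 'k)" and n r
  have "\<exists>h. \<forall>n. P h n (h n)"
  proof (rule dependent_wellorder_choice)
    show "P f n r = P h n r" if "\<And>j. j < n \<Longrightarrow> f j = h j" for r f h n
      using that by (auto simp: P_def)
    fix n and h :: "nat \<Rightarrow> 'a \<times> ('a \<Rightarrow> 'k)"
    assume prev: "\<And>j. j < n \<Longrightarrow> P h j (h j)"
    define \<Phi> where "\<Phi> = (\<lambda>j. snd (h j)) ` {..<n}"
    have "finite \<Phi>" "\<Phi> \<subseteq> dual_ball" using prev by (auto simp: \<Phi>_def P_def)
    then obtain y where y: "y \<in> Y" "\<forall>f\<in>\<Phi>. f y = 0" "norm (S y) < \<epsilon> n * norm y"
      using sing eps[of n] unfolding finitely_singular_def by (meson not_le)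
    \<comment> \<open>The strict inequality for \<open>S y\<close> excludes
      \<open>y = 0\<close>.\<close>
    then have "norm y > 0" using eps[of n] norm_ge_zero[of "S y"]
      by (cases "y = 0") auto
    define x where "x = (1 / norm y) *\<^sub>R y"
    have x: "x \<in> Y" "norm x = 1" using y(1) \<open>norm y > 0\<close> by (auto simp: x_def subspace_scaleR[OF Y])
    have "S x = (1 / norm y) *\<^sub>R S y" unfolding x_def by (rule operators_scaleR[OF T y(1)])
    then have Sx: "norm (S x) \<le> \<epsilon> n" using y(3) \<open>norm y > 0\<close> by (simp add: pos_divide_le_eq)
    have "f x = 0" if "f \<in> \<Phi>" for f
      using y(2) that \<open>\<Phi> \<subseteq> dual_ball\<close> unfolding x_def scaleR_eq_scale
      by (subst dual_ball_scale) auto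
    moreover obtain g where "g \<in> dual_ball" "g x = 1"
      using dual_ball_norming[of x] x(2) by auto
    ultimately show "\<exists>r. P h n r"
      using x Sx by (intro exI[of _ "(x, g)"]) (auto simp: P_def \<Phi>_def)
  qed
  then obtain h where "\<And>n. P h n (h n)" by blast
  then show thesis
    by (intro that[of "\<lambda>n. fst (h n)" "\<lambda>n. snd (h n)"]) (auto simp: P_def)
qed

text \<open>The coefficient bound carries smallness from the vectors \<open>w n\<close> to their
  span, and continuity of \<open>S\<close> carries it to the closure. The triangular functionals
  keep this closure infinite-dimensional.\<close>

lemma infinitely_singular_small_subspace:
  assumes Y: "subspace Y" "closed Y" and S: "S \<in> operators Y UNIV"
    and sing: "\<not> finitely_singular Y S" and eps: "0 < \<epsilon>"
  obtains W where "inf_dim_closed_subspace W" "W \<subseteq> Y" "\<And>x. x \<in> W \<Longrightarrow> norm (S x) \<le> \<epsilon> * norm x"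
proof -
  \<comment> \<open>Coefficients may grow like \<open>2 ^ n\<close>; the factor \<open>4 ^ n\<close>
    leaves a geometric series with sum at most 2, which the factor \<open>\<epsilon> / 2\<close>
    compensates.\<close>
  have pos: "0 < \<epsilon> / 2 / 4 ^ n" for n :: nat using eps by simp
  obtain w g where w: "\<And>n. w n \<in> Y" "\<And>n. norm (w n) = 1" "\<And>n. norm (S (w n)) \<le> \<epsilon> / 2 / 4 ^ n"
    and g: "\<And>n. g n \<in> dual_ball" "\<And>n. g n (w n) = 1" "\<And>j n::nat. j < n \<Longrightarrow> g j (w n) = 0"
    by (rule infinitely_singular_sequence[OF Y(1) S sing, of "\<lambda>n. \<epsilon> / 2 / 4 ^ n", OF pos])
      (rule that)
  define W where "W = closure (span (range w))"
  have span_Y: "span (range w) \<subseteq> Y" using w(1) Y(1) by (intro span_minimal) auto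
  have small: "norm (S x) \<le> \<epsilon> * norm x" if "x \<in> span (range w)" for x
  proof -
    obtain n a where x: "x = (\<Sum>k<n. a k *\<^sub>K w k)" using span_range_sum[OF \<open>x \<in> span (range w)\<close>] .
    have "S x = (\<Sum>k<n. a k *\<^sub>K S (w k))" unfolding x using w(1) by (intro operators_sum[OF Y(1) S])
    also have "norm \<dots> \<le> (\<Sum>k<n. (1 / 2) ^ k * (\<epsilon> / 2 * norm x))"
    proof (rule sum_norm_le)
      fix k assume "k \<in> {..<n}"
      then have "norm (a k) \<le> 2 ^ k * norm x"
        unfolding x using triangular_coeff_bound[of g w, OF g w(2)] by auto
      then have "norm (a k *\<^sub>K S (w k)) \<le> (2 ^ k * norm x) * (\<epsilon> / 2 / 4 ^ k)"
        unfolding norm_scale using w(3) by (intro mult_mono) auto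
      also have "\<dots> = (1 / 2) ^ k * (\<epsilon> / 2 * norm x)"
        using power_mult_distrib[of "2::real" 2 k] by (simp add: power_divide mult.commute)
      finally show "norm (a k *\<^sub>K S (w k)) \<le> (1 / 2) ^ k * (\<epsilon> / 2 * norm x)" .
    qed
    also have "\<dots> = (\<Sum>k<n. (1 / 2) ^ k) * (\<epsilon> / 2 * norm x)" by (simp add: sum_distrib_right)
    also have "(\<Sum>k<n. (1 / 2) ^ k) \<le> (2 :: real)" by (simp add: geometric_sum)
    then have "(\<Sum>k<n. (1 / 2) ^ k) * (\<epsilon> / 2 * norm x) \<le> 2 * (\<epsilon> / 2 * norm x)"
      using eps by (intro mult_right_mono) auto
    finally show ?thesis by simp
  qed
  obtain C where C: "0 < C" "\<And>y. y \<in> Y \<Longrightarrow> norm (S y) \<le> C * norm y"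
    using operators_bound[OF S] by blast
  have "C-lipschitz_on Y S"
    using C by (intro lipschitz_onI)
      (auto simp: dist_norm subspace_diff[OF Y(1)] simp flip: operators_diff[OF Y(1) S])
  then have "continuous_on Y S" by (rule lipschitz_on_continuous_on)
  then have "closed {x \<in> Y. norm (S x) \<le> \<epsilon> * norm x}"
    using Y(2) by (intro continuous_on_closed_Collect_le continuous_intros)
  then have "W \<subseteq> {x \<in> Y. norm (S x) \<le> \<epsilon> * norm x}"
    unfolding W_def using small span_Y by (intro closure_minimal) auto
  moreover have "inf_dim_closed_subspace W"
  proof -
    have range: "range w \<subseteq> W"
      unfolding W_def by (rule order_trans[OF span_superset closure_subset])
    have "span B \<noteq> W" if "finite B" for B
      by (rule triangular_not_finite_span[of g w, OF g range that])
    then have "\<not> (\<exists>B. finite B \<and> span B = W)" by blast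
    then show ?thesis
      unfolding inf_dim_closed_subspace_def W_def by (simp add: subspace_closure)
  qed
  ultimately show thesis using that by blast
qed

text \<open>A combination of the values at \<open>a + b\<close>, \<open>a\<close> and
  \<open>b\<close> eliminates \<open>T\<close> and leaves the determinant
  \<open>s' * r - s * r'\<close> times \<open>b\<close>. The values at \<open>a\<close> and
  \<open>b\<close> are the small errors.\<close>

lemma line_estimate:
  assumes Y: "subspace Y" and T: "T \<in> operators Y UNIV"
    and C: "\<And>y. y \<in> Y \<Longrightarrow> norm (T y) \<le> C * norm y"
    and ab: "a \<in> Y" "b \<in> Y"
    and small: "norm (r *\<^sub>R a + s *\<^sub>R T a) \<le> \<epsilon> * norm a" "norm (r' *\<^sub>R b + s' *\<^sub>R T b) \<le> \<epsilon> * norm b"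
    and le1: "\<bar>r\<bar> \<le> 1" "\<bar>s\<bar> \<le> 1" "\<bar>s'\<bar> \<le> 1"
  shows "\<bar>s' * r - s * r'\<bar> * norm b \<le> (1 + C) * norm (a + b) + \<epsilon> * (norm a + norm b)"
proof -
  let ?x = "a + b"
  let ?u = "r *\<^sub>R a + s *\<^sub>R T a" and ?v = "r' *\<^sub>R b + s' *\<^sub>R T b" and ?p = "r *\<^sub>R ?x + s *\<^sub>R T ?x"
  have x: "?x \<in> Y" using ab Y by (simp add: subspace_add)
  have "(s' * r - s * r') *\<^sub>R b = s' *\<^sub>R ?p - s' *\<^sub>R ?u - s *\<^sub>R ?v"
    by (simp add: operators_add[OF T ab] algebra_simps)
  then have "\<bar>s' * r - s * r'\<bar> * norm b = norm (s' *\<^sub>R ?p - s' *\<^sub>R ?u - s *\<^sub>R ?v)"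
    by (metis norm_scaleR)
  also have "\<dots> \<le> \<bar>s'\<bar> * norm ?p + \<bar>s'\<bar> * norm ?u + \<bar>s\<bar> * norm ?v"
    using norm_triangle_ineq4[of "s' *\<^sub>R ?p - s' *\<^sub>R ?u" "s *\<^sub>R ?v"]
      norm_triangle_ineq4[of "s' *\<^sub>R ?p" "s' *\<^sub>R ?u"] by simp
  also have "\<dots> \<le> norm ?p + norm ?u + norm ?v"
    using le1 by (intro add_mono mult_left_le_one_le) auto
  also have "norm ?p \<le> \<bar>r\<bar> * norm ?x + \<bar>s\<bar> * norm (T ?x)"
    using norm_triangle_ineq[of "r *\<^sub>R ?x" "s *\<^sub>R T ?x"] by simp
  also have "\<dots> \<le> norm ?x + norm (T ?x)"
    using le1 by (intro add_mono mult_left_le_one_le) auto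
  also have "norm (T ?x) \<le> C * norm ?x" by (rule C[OF x])
  finally show ?thesis using small by (simp add: algebra_simps)
qed

text \<open>If both operators failed, each would be small on an infinite-dimensional closed
  subspace. As the coefficient pairs are not proportional, \<open>line_estimate\<close> bounds both
  components by their sum, so these subspaces would form a topological direct sum.\<close>

lemma HI_one_singular_direction:
  assumes HI: hereditarily_indecomposable and Y: "subspace Y" "closed Y"
    and T: "T \<in> operators Y UNIV"
    and le1: "\<bar>r\<bar> \<le> 1" "\<bar>s\<bar> \<le> 1" "\<bar>r'\<bar> \<le> 1" "\<bar>s'\<bar> \<le> 1" and ne: "s' * r \<noteq> s * r'"
  shows "finitely_singular Y (\<lambda>y\<in>Y. r *\<^sub>R y + s *\<^sub>R T y) \<or>
    finitely_singular Y (\<lambda>y\<in>Y. r' *\<^sub>R y + s' *\<^sub>R T y)"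
proof (rule ccontr)
  assume "\<not> ?thesis"
  then have sing: "\<not> finitely_singular Y (\<lambda>y\<in>Y. r *\<^sub>R y + s *\<^sub>R T y)"
    "\<not> finitely_singular Y (\<lambda>y\<in>Y. r' *\<^sub>R y + s' *\<^sub>R T y)" by auto
  have op: "(\<lambda>y\<in>Y. r *\<^sub>R y + s *\<^sub>R T y) \<in> operators Y UNIV" for r s
  proof -
    have "(\<lambda>y\<in>Y. r *\<^sub>R inclusion Y y + s *\<^sub>R T y) \<in> operators Y UNIV"
      using Emb_operators[OF inclusion_in_Emb[OF Y(1)]] T by (intro operators_lincomb Y)
    also have "(\<lambda>y\<in>Y. r *\<^sub>R inclusion Y y + s *\<^sub>R T y) = (\<lambda>y\<in>Y. r *\<^sub>R y + s *\<^sub>R T y)"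
      by (auto simp: inclusion_def)
    finally show ?thesis .
  qed
  obtain C where C: "0 < C" "\<And>y. y \<in> Y \<Longrightarrow> norm (T y) \<le> C * norm y"
    using operators_bound[OF T] by blast
  let ?d = "\<bar>s' * r - s * r'\<bar>"
  \<comment> \<open>With errors of size \<open>?d / 4\<close> the two estimates below add up to an
    error of half the left side, which can be absorbed.\<close>
  have d: "0 < ?d / 4" using ne by simp
  obtain A where A: "inf_dim_closed_subspace A" "A \<subseteq> Y"
    "\<And>x. x \<in> A \<Longrightarrow> norm ((\<lambda>y\<in>Y. r *\<^sub>R y + s *\<^sub>R T y) x) \<le> ?d / 4 * norm x"
    using infinitely_singular_small_subspace[OF Y op sing(1) d] by blast
  obtain B where B: "inf_dim_closed_subspace B" "B \<subseteq> Y"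
    "\<And>x. x \<in> B \<Longrightarrow> norm ((\<lambda>y\<in>Y. r' *\<^sub>R y + s' *\<^sub>R T y) x) \<le> ?d / 4 * norm x"
    using infinitely_singular_small_subspace[OF Y op sing(2) d] by blast
  have "norm a + norm b \<le> (4 * (1 + C) / ?d) * norm (a + b)" if ab: "a \<in> A" "b \<in> B" for a b
  proof -
    have aY: "a \<in> Y" and bY: "b \<in> Y" using ab A(2) B(2) by auto
    have a: "norm (r *\<^sub>R a + s *\<^sub>R T a) \<le> ?d / 4 * norm a" using A(3)[OF ab(1)] aY by simp
    have b: "norm (r' *\<^sub>R b + s' *\<^sub>R T b) \<le> ?d / 4 * norm b" using B(3)[OF ab(2)] bY by simp
    have "?d * norm b \<le> (1 + C) * norm (a + b) + ?d / 4 * (norm a + norm b)"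
      using a b le1 by (intro line_estimate[OF Y(1) T C(2) aY bY])
    \<comment> \<open>The same estimate with \<open>a\<close> and \<open>b\<close> exchanged; the
      determinant only changes its sign.\<close>
    moreover have "?d * norm a \<le> (1 + C) * norm (b + a) + ?d / 4 * (norm b + norm a)"
      using line_estimate[OF Y(1) T C(2) bY aY b a le1(3,4,2)]
      by (simp add: abs_minus_commute mult.commute)
    moreover have "d * (p + q) \<le> 4 * K"
      if "d * q \<le> K + d / 4 * (p + q)" "d * p \<le> K + d / 4 * (q + p)" for d p q K :: real
    proof -
      have "d / 4 * (p + q) = (d * p + d * q) / 4" by (simp add: algebra_simps)
      then show ?thesis using that by (simp add: add.commute[of q p] distrib_left)
    qed
    ultimately have "?d * (norm a + norm b) \<le> 4 * ((1 + C) * norm (a + b))"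
      by (simp only: add.commute[of b a])
    then have "?d * (norm a + norm b) \<le> (4 * (1 + C)) * norm (a + b)"
      by (simp only: mult.assoc)
    then show ?thesis using d by (simp add: pos_le_divide_eq mult.commute)
  qed
  then have "topological_direct_sum A B"
    using A(1) B(1) unfolding inf_dim_closed_subspace_def by (intro topological_direct_sumI) blast+
  then show False using HI A(1) B(1) unfolding hereditarily_indecomposable_def by blast
qed

text \<open>The coefficient pairs on the segments towards \<open>T\<close> and towards
  \<open>- T\<close> are never proportional at interior parameters, so at most one of the segments
  contains an exception. The operators at the endpoints are bounded below on all of
  \<open>Y\<close>.\<close>

lemma segment_finitely_singular:
  assumes HI: hereditarily_indecomposable and Y: "subspace Y" "closed Y"
    and T: "T \<in> Emb Y"
  obtains \<sigma> where "\<sigma> = 1 \<or> \<sigma> = -1"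
    "\<And>t. t \<in> {0..1} \<Longrightarrow> finitely_singular Y (\<lambda>y\<in>Y. (1 - t) *\<^sub>R y + t *\<^sub>R \<sigma> *\<^sub>R T y)"
proof -
  define P where "P \<sigma> t \<longleftrightarrow> finitely_singular Y (\<lambda>y\<in>Y. (1 - t) *\<^sub>R y + (t * \<sigma>) *\<^sub>R T y)"
    for \<sigma> t :: real
  obtain c where c: "0 < c" "\<And>y. y \<in> Y \<Longrightarrow> c * norm y \<le> norm (T y)"
    using Emb_lower[OF T] by blast
  have P0: "P \<sigma> 0" for \<sigma>
    unfolding P_def finitely_singular_def by (intro exI[of _ "{}"] exI[of _ 1]) simp
  have P1: "P \<sigma> 1" if "\<bar>\<sigma>\<bar> = 1" for \<sigma>
    unfolding P_def finitely_singular_def using c that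
    by (intro exI[of _ "{}"] exI[of _ c]) simp
  have "(\<forall>t\<in>{0..1}. P 1 t) \<or> (\<forall>t\<in>{0..1}. P (-1) t)"
  proof (rule ccontr)
    assume "\<not> ?thesis"
    then obtain t t' where t: "t \<in> {0..1}" "\<not> P 1 t" and t': "t' \<in> {0..1}" "\<not> P (-1) t'" by blast
    have "t \<noteq> 0" "t' \<noteq> 0" "t \<noteq> 1" "t' \<noteq> 1" using t t' P0 P1 by auto
    then have pos: "0 < t" "t < 1" "0 < t'" "t' < 1" using t t' by auto
    \<comment> \<open>This is minus the determinant of the coefficient pairs
      \<open>(1 - t, t)\<close> and \<open>(1 - t', - t')\<close>.\<close>
    then have "0 < t' * (1 - t) + t * (1 - t')" by (simp add: add_pos_pos)
    then have "t' * -1 * (1 - t) \<noteq> t * 1 * (1 - t')" by linarith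
    then have "P 1 t \<or> P (-1) t'"
      unfolding P_def using pos
      by (intro HI_one_singular_direction[OF HI Y Emb_operators[OF T]]) auto
    then show False using t t' by blast
  qed
  then show thesis
    using that[of 1] that[of "-1"] unfolding P_def by auto
qed

text \<open>A lower bound on a common kernel survives small changes of \<open>t\<close>. Compactness
  leaves finitely many families of functionals, and their union works for all \<open>t\<close> with
  half of the smallest constant.\<close>

lemma segment_uniformly_finitely_singular:
  assumes Y: "subspace Y" and T: "T \<in> operators Y UNIV"
    and sing: "\<And>t. t \<in> {0..1} \<Longrightarrow> finitely_singular Y (\<lambda>y\<in>Y. (1 - t) *\<^sub>R y + t *\<^sub>R T y)"
  obtains \<Phi> c where "finite \<Phi>" "\<Phi> \<subseteq> dual_ball" "0 < c"
    "\<And>t y. t \<in> {0..1} \<Longrightarrow> y \<in> Y \<Longrightarrow> \<forall>f\<in>\<Phi>. f y = 0 \<Longrightarrow>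
      c * norm y \<le> norm ((1 - t) *\<^sub>R y + t *\<^sub>R T y)"
proof -
  let ?S = "\<lambda>t y. (1 - t) *\<^sub>R y + t *\<^sub>R T y"
  define Q where "Q t p \<longleftrightarrow> finite (fst p) \<and> fst p \<subseteq> dual_ball \<and> 0 < snd p \<and>
      (\<forall>y\<in>Y. (\<forall>f\<in>fst p. f y = 0) \<longrightarrow> snd p * norm y \<le> norm (?S t y))"
    for t and p :: "('a \<Rightarrow> 'k) set \<times> real"
  define p where "p t = (SOME p. Q t p)" for t
  have ex: "\<exists>p. Q t p" if t: "t \<in> {0..1}" for t
  proof -
    obtain \<Phi> c where "finite \<Phi>" "\<Phi> \<subseteq> dual_ball" "0 < c"
      "\<forall>y\<in>Y. (\<forall>f\<in>\<Phi>. f y = 0) \<longrightarrow> c * norm y \<le> norm (?S t y)"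
      using sing[OF t] unfolding finitely_singular_def by (elim exE conjE) (rule that, auto)
    then show ?thesis unfolding Q_def by (intro exI[of _ "(\<Phi>, c)"] conjI) (simp_all only: fst_conv snd_conv)
  qed
  have p: "Q t (p t)" if "t \<in> {0..1}" for t unfolding p_def by (rule someI_ex[OF ex[OF that]])
  define \<Phi> c where "\<Phi> t = fst (p t)" and "c t = snd (p t)" for t
  have fin: "finite (\<Phi> t)" and dual: "\<Phi> t \<subseteq> dual_ball" and c: "0 < c t" if "t \<in> {0..1}" for t
    using p[OF that] by (auto simp: \<Phi>_def c_def Q_def)
  have lower: "c t * norm y \<le> norm (?S t y)"
    if "t \<in> {0..1}" "y \<in> Y" "\<forall>f\<in>\<Phi> t. f y = 0" for t y
    using p[OF that(1)] that by (auto simp: \<Phi>_def c_def Q_def)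
  obtain K where K: "0 < K" "\<And>y. y \<in> Y \<Longrightarrow> norm (T y) \<le> K * norm y"
    using operators_bound[OF T] by blast
  \<comment> \<open>The operators are Lipschitz in the parameter with constant \<open>1 + K\<close>,
    so within distance \<open>c t / ?L\<close> of \<open>t\<close> half of the lower bound
    survives.\<close>
  let ?L = "2 * (1 + K)"
  obtain I where I: "I \<subseteq> {0..1}" "finite I" "{0..1} \<subseteq> (\<Union>t\<in>I. ball t (c t / ?L))"
  proof (rule compactE_image)
    show "compact {0..1::real}" by simp
    show "{0..1} \<subseteq> (\<Union>t\<in>{0..1}. ball t (c t / ?L))" using c K(1) by force
  qed auto
  have "I \<noteq> {}" using I(3) by force
  show thesis
  proof (rule that)
    show "finite (\<Union>t\<in>I. \<Phi> t)" "(\<Union>t\<in>I. \<Phi> t) \<subseteq> dual_ball" using I(1,2) fin dual by blast+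
    show "0 < Min (c ` I) / 2" using I(1,2) \<open>I \<noteq> {}\<close> c by auto
    fix t :: real and y assume t: "t \<in> {0..1}" and y: "y \<in> Y" "\<forall>f\<in>(\<Union>t\<in>I. \<Phi> t). f y = 0"
    obtain s where s: "s \<in> I" "\<bar>s - t\<bar> < c s / ?L" using I(3) t by (force simp: dist_real_def)
    have "\<bar>s - t\<bar> * (1 + K) \<le> c s / 2" using s(2) K(1) by (simp add: field_simps)
    have "?S s y - ?S t y = (s - t) *\<^sub>R (T y - y)" by (simp add: algebra_simps)
    then have "norm (?S s y - ?S t y) = \<bar>s - t\<bar> * norm (T y - y)" by simp
    also have "\<dots> \<le> \<bar>s - t\<bar> * ((1 + K) * norm y)"
      using norm_triangle_ineq4[of "T y" y] K(2)[OF y(1)]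
      by (intro mult_left_mono) (auto simp: algebra_simps)
    also have "\<dots> \<le> c s / 2 * norm y"
      unfolding mult.assoc[symmetric] by (intro mult_right_mono \<open>\<bar>s - t\<bar> * (1 + K) \<le> c s / 2\<close>) simp
    finally have "norm (?S s y - ?S t y) \<le> c s / 2 * norm y" .
    moreover have "c s * norm y \<le> norm (?S s y)" using s(1) I(1) y by (intro lower) auto
    ultimately have "c s / 2 * norm y \<le> norm (?S t y)"
      using norm_triangle_ineq2[of "?S s y" "?S t y"] by linarith
    moreover have "Min (c ` I) / 2 * norm y \<le> c s / 2 * norm y"
      using s(1) I(2) by (intro mult_right_mono divide_right_mono) auto
    ultimately show "Min (c ` I) / 2 * norm y \<le> norm (?S t y)" by linarith
  qed
qed

end

subsection \<open>Segments of embeddings\<close>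

context banach_space
begin

text \<open>Paths of embeddings are treated as finite chains of straight segments. The lower bound
  is uniform along a segment because the number of pieces used to lift the segment depends on
  it.\<close>

definition linked :: "'a set \<Rightarrow> ('a \<Rightarrow> 'a) \<Rightarrow> ('a \<Rightarrow> 'a) \<Rightarrow> bool" where
  "linked Y A B \<longleftrightarrow> A \<in> operators Y UNIV \<and> B \<in> operators Y UNIV \<and>
    (\<exists>c>0. \<forall>t\<in>{0..1}. \<forall>y\<in>Y. c * norm y \<le> norm ((1 - t) *\<^sub>R A y + t *\<^sub>R B y))"

lemma linkedI:
  assumes "A \<in> operators Y UNIV" "B \<in> operators Y UNIV" "0 < c"
    "\<And>t y. t \<in> {0..1} \<Longrightarrow> y \<in> Y \<Longrightarrow> c * norm y \<le> norm ((1 - t) *\<^sub>R A y + t *\<^sub>R B y)"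
  shows "linked Y A B"
  using assms by (auto simp: linked_def)

lemma linked_Emb:
  assumes "subspace Y" "linked Y A B" "t \<in> {0..1}"
  shows "(\<lambda>y\<in>Y. (1 - t) *\<^sub>R A y + t *\<^sub>R B y) \<in> Emb Y"
proof -
  obtain c where c: "0 < c" "\<forall>t\<in>{0..1}. \<forall>y\<in>Y. c * norm y \<le> norm ((1 - t) *\<^sub>R A y + t *\<^sub>R B y)"
    using assms(2) by (auto simp: linked_def)
  show ?thesis
    using c assms(2,3)
    by (intro EmbI[OF operators_lincomb[OF assms(1)] c(1)]) (auto simp: linked_def)
qed

lemma linked_endpoints:
  assumes "A \<in> operators Y UNIV" "B \<in> operators Y UNIV"
  shows "(\<lambda>y\<in>Y. (1 - 0) *\<^sub>R A y + 0 *\<^sub>R B y) = A" "(\<lambda>y\<in>Y. (1 - 1) *\<^sub>R A y + 1 *\<^sub>R B y) = B"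
  using assms[THEN operators_extensional] by (auto simp: extensional_restrict)

lemma linked_Emb_endpoints:
  assumes "subspace Y" "linked Y A B"
  shows "A \<in> Emb Y" "B \<in> Emb Y"
proof -
  have "A \<in> operators Y UNIV" "B \<in> operators Y UNIV" using assms(2) by (auto simp: linked_def)
  note * = linked_endpoints[OF this]
  show "A \<in> Emb Y" "B \<in> Emb Y"
    using linked_Emb[OF assms, of 0] linked_Emb[OF assms, of 1] unfolding * by auto
qed

text \<open>The segment is Lipschitz in the operator norm; the constant is the sum of bounds for the
  two endpoints.\<close>

lemma linked_path:
  assumes Y: "subspace Y" and "linked Y A B"
  shows "path_component_of (Emb_topology Y) A B"
proof -
  interpret E: Metric_space "Emb Y" "Emb_dist Y" by (rule Metric_space_Emb[OF Y])
  have ops: "A \<in> operators Y UNIV" "B \<in> operators Y UNIV"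
    using assms(2) by (auto simp: linked_def)
  obtain a b where ab: "0 < a" "\<And>y. y \<in> Y \<Longrightarrow> norm (A y) \<le> a * norm y"
    "0 < b" "\<And>y. y \<in> Y \<Longrightarrow> norm (B y) \<le> b * norm y"
    using operators_bound[OF ops(1)] operators_bound[OF ops(2)] by metis
  define g where "g t = (\<lambda>y\<in>Y. (1 - t) *\<^sub>R A y + t *\<^sub>R B y)" for t :: real
  have g: "g t \<in> Emb Y" if "t \<in> {0..1}" for t
    unfolding g_def by (rule linked_Emb[OF assms that])
  have dist: "Emb_dist Y (g s) (g t) \<le> \<bar>s - t\<bar> * (a + b)" if st: "s \<in> {0..1}" "t \<in> {0..1}" for s t
  proof -
    have "norm (g s y - g t y) / norm y \<le> \<bar>s - t\<bar> * (a + b)" if y: "y \<in> Y" for y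
    proof (cases "y = 0")
      case True
      then show ?thesis using ab by simp
    next
      case False
      have "g s y - g t y = (s - t) *\<^sub>R (B y - A y)" using y by (simp add: g_def algebra_simps)
      then have "norm (g s y - g t y) = \<bar>s - t\<bar> * norm (B y - A y)" by simp
      also have "\<dots> \<le> \<bar>s - t\<bar> * ((a + b) * norm y)"
        using norm_triangle_ineq4[of "B y" "A y"] ab(2,4)[OF y]
        by (intro mult_left_mono) (auto simp: algebra_simps)
      finally show ?thesis using False by (simp add: divide_simps mult.assoc)
    qed
    then show ?thesis
      unfolding Emb_dist_def using g[OF st(1)] g[OF st(2)] subspace_0[OF Y]
      by (auto intro!: cSUP_least)
  qed
  have "continuous_map (top_of_set {0..1}) E.mtopology g"
    unfolding E.continuous_map_to_metric
  proof (intro ballI allI impI)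
    fix t \<epsilon> :: real assume t: "t \<in> topspace (top_of_set {0..1})" and eps: "0 < \<epsilon>"
    let ?U = "{0..1} \<inter> ball t (\<epsilon> / (a + b))"
    have "g s \<in> E.mball (g t) \<epsilon>" if s: "s \<in> ?U" for s
    proof -
      have "Emb_dist Y (g t) (g s) \<le> \<bar>t - s\<bar> * (a + b)" using s t by (intro dist) auto
      also have "\<dots> < \<epsilon>" using s ab by (simp add: dist_real_def pos_less_divide_eq)
      finally show ?thesis using g s t by simp
    qed
    moreover have "openin (top_of_set {0..1}) ?U" by (simp add: openin_open_Int)
    moreover have "t \<in> ?U" using t eps ab by simp
    ultimately show "\<exists>U. openin (top_of_set {0..1}) U \<and> t \<in> U \<and> (\<forall>s\<in>U. g s \<in> E.mball (g t) \<epsilon>)"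
      by blast
  qed
  then have "pathin (Emb_topology Y) g"
    by (simp add: pathin_def Emb_topology_def)
  moreover have "g 0 = A" "g 1 = B" unfolding g_def by (rule linked_endpoints[OF ops])+
  ultimately show ?thesis unfolding path_component_of_def by blast
qed

lemma linked_rtranclp_path:
  assumes "subspace Y" "(linked Y)\<^sup>*\<^sup>* A B" "A \<in> Emb Y"
  shows "path_component_of (Emb_topology Y) A B"
  using assms(2)
proof (induction rule: rtranclp_induct)
  case base
  interpret E: Metric_space "Emb Y" "Emb_dist Y" by (rule Metric_space_Emb[OF assms(1)])
  show ?case using assms(3) by (simp add: path_component_of_refl Emb_topology_def)
next
  case (step B C)
  then show ?case using linked_path[OF assms(1)] path_component_of_trans by metis
qed

end

subsection \<open>Extending a path by one dimension\<close>

lemma infdist_greatest: "A \<noteq> {} \<Longrightarrow> (\<And>a. a \<in> A \<Longrightarrow> d \<le> dist x a) \<Longrightarrow> d \<le> infdist x A"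
  by (simp add: infdist_notempty cINF_greatest)

text \<open>If the segments from \<open>b\<close> to \<open>z\<close> and to \<open>- z\<close> both
  met \<open>V\<close>, eliminating \<open>b\<close> from the two points would put a positive
  multiple of \<open>z\<close> into \<open>V\<close>. Compactness turns avoidance into a positive
  distance.\<close>

lemma segment_avoids_subspace:
  fixes V :: "'a::real_normed_vector set"
  assumes V: "subspace V" "closed V" and b: "b \<notin> V" and z: "z \<notin> V"
  obtains \<sigma> d :: real where "\<sigma> = 1 \<or> \<sigma> = -1" "0 < d"
    "\<And>t. t \<in> {0..1} \<Longrightarrow> d \<le> infdist ((1 - t) *\<^sub>R b + t *\<^sub>R \<sigma> *\<^sub>R z) V"
proof -
  let ?p = "\<lambda>\<sigma> t. (1 - t) *\<^sub>R b + t *\<^sub>R \<sigma> *\<^sub>R z"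
  have "\<exists>\<sigma>::real. (\<sigma> = 1 \<or> \<sigma> = -1) \<and> (\<forall>t\<in>{0..1}. ?p \<sigma> t \<notin> V)"
  proof (rule ccontr)
    assume neg: "\<not> ?thesis"
    from neg obtain t where t: "t \<in> {0..1}" "?p 1 t \<in> V" by blast
    from neg obtain s where s: "s \<in> {0..1}" "?p (-1) s \<in> V" by blast
    have ne: "t \<noteq> 0" "t \<noteq> 1" "s \<noteq> 0" "s \<noteq> 1"
      using t s b z subspace_neg[OF V(1), of "-z"] by auto
    have "(1 - s) *\<^sub>R ?p 1 t - (1 - t) *\<^sub>R ?p (-1) s \<in> V"
      using t s V(1) by (intro subspace_diff subspace_scale)
    moreover have "(1 - s) *\<^sub>R ?p 1 t - (1 - t) *\<^sub>R ?p (-1) s = ((1 - s) * t + (1 - t) * s) *\<^sub>R z"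
      by (simp add: algebra_simps flip: scaleR_2)
    ultimately have *: "((1 - s) * t + (1 - t) * s) *\<^sub>R z \<in> V" by simp
    have "0 < (1 - s) * t + (1 - t) * s" using t s ne by (intro add_pos_pos mult_pos_pos) auto
    then have "z \<in> V"
      using subspace_scale[OF V(1) *, of "1 / ((1 - s) * t + (1 - t) * s)"] by simp
    then show False using z by simp
  qed
  then obtain \<sigma> :: real where \<sigma>: "\<sigma> = 1 \<or> \<sigma> = -1" "\<And>t. t \<in> {0..1} \<Longrightarrow> ?p \<sigma> t \<notin> V" by blast
  have "\<exists>t\<in>{0..1}. \<forall>s\<in>{0..1}. infdist (?p \<sigma> t) V \<le> infdist (?p \<sigma> s) V"
    by (rule continuous_attains_inf) (simp_all add: continuous_intros)
  then obtain t where t: "t \<in> {0..1}" "\<And>s. s \<in> {0..1} \<Longrightarrow> infdist (?p \<sigma> t) V \<le> infdist (?p \<sigma> s) V"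
    by blast
  have "0 < infdist (?p \<sigma> t) V"
    using V \<sigma>(2)[OF t(1)] subspace_0 by (intro infdist_pos_not_in_closed) auto
  then show thesis using that \<sigma>(1) t(2) by blast
qed

context banach_space
begin

text \<open>For nonzero \<open>k\<close> the vector is \<open>k\<close> times the difference of
  \<open>z\<close> and a point of \<open>V\<close>. The larger set \<open>W\<close> allows the
  distance to a closure.\<close>

lemma norm_ge_infdist:
  assumes "subspace V" "v \<in> V" "V \<subseteq> W"
  shows "norm k * infdist z W \<le> norm (v + k *\<^sub>K z)"
proof (cases "k = 0")
  case False
  have "inverse k *\<^sub>K (- v) \<in> W" using assms by (auto intro: subspace_scale subspace_neg)
  then have "infdist z W \<le> norm (z - inverse k *\<^sub>K (- v))"
    by (metis infdist_le dist_norm)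
  then have "norm k * infdist z W \<le> norm (k *\<^sub>K (z - inverse k *\<^sub>K (- v)))"
    unfolding norm_scale by (intro mult_left_mono) auto
  also have "k *\<^sub>K (z - inverse k *\<^sub>K (- v)) = v + k *\<^sub>K z"
    using False by (simp add: scale_right_distrib add.commute)
  finally show ?thesis .
qed simp

context
  fixes Y Y0 :: "'a set" and f :: "'a \<Rightarrow> 'k" and e :: 'a
  assumes Y: "subspace Y" and f: "f \<in> dual_ball" and e: "e \<in> Y" "f e = 1"
  defines "Y0 \<equiv> {y \<in> Y. f y = 0}"
begin

lemma kernel_subspace: "subspace Y0" and kernel_subset: "Y0 \<subseteq> Y"
  using subspace_kernel[OF Y f] by (auto simp: Y0_def)

lemma kernel_part: "y \<in> Y \<Longrightarrow> y - f y *\<^sub>K e \<in> Y0"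
  using e Y by (simp add: Y0_def dual_ball_diff[OF f] dual_ball_scale[OF f]
      subspace_diff subspace_scale)

text \<open>The vector \<open>y\<close> is split into a vector of \<open>Y0\<close> and a multiple
  of \<open>e\<close>. For linear \<open>B\<close> on \<open>Y0\<close> this is the linear extension
  that sends \<open>e\<close> to \<open>x\<close>.\<close>

definition extend :: "('a \<Rightarrow> 'a) \<Rightarrow> 'a \<Rightarrow> 'a \<Rightarrow> 'a" where
  "extend B x = (\<lambda>y\<in>Y. B (y - f y *\<^sub>K e) + f y *\<^sub>K x)"

lemma extend_operators:
  assumes B: "B \<in> operators Y0 UNIV"
  shows "extend B x \<in> operators Y UNIV"
  unfolding extend_def
proof -
  obtain C where C: "0 < C" "\<And>y. y \<in> Y0 \<Longrightarrow> norm (B y) \<le> C * norm y"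
    using operators_bound[OF B] by blast
  show "(\<lambda>y\<in>Y. B (y - f y *\<^sub>K e) + f y *\<^sub>K x) \<in> operators Y UNIV"
  proof (rule operatorsI[OF _ _ _ Y])
    fix u v assume uv: "u \<in> Y" "v \<in> Y"
    have eq: "u + v - f (u + v) *\<^sub>K e = (u - f u *\<^sub>K e) + (v - f v *\<^sub>K e)"
      by (simp add: dual_ball_add[OF f] scale_left_distrib)
    have "B (u + v - f (u + v) *\<^sub>K e) = B (u - f u *\<^sub>K e) + B (v - f v *\<^sub>K e)"
      unfolding eq by (rule operators_add[OF B kernel_part[OF uv(1)] kernel_part[OF uv(2)]])
    then show "B (u + v - f (u + v) *\<^sub>K e) + f (u + v) *\<^sub>K x =
        B (u - f u *\<^sub>K e) + f u *\<^sub>K x + (B (v - f v *\<^sub>K e) + f v *\<^sub>K x)"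
      by (simp only: dual_ball_add[OF f] scale_left_distrib add_ac)
  next
    fix c y assume y: "y \<in> Y"
    have "c *\<^sub>K y - f (c *\<^sub>K y) *\<^sub>K e = c *\<^sub>K (y - f y *\<^sub>K e)"
      by (simp add: dual_ball_scale[OF f] scale_right_diff_distrib)
    then show "B (c *\<^sub>K y - f (c *\<^sub>K y) *\<^sub>K e) + f (c *\<^sub>K y) *\<^sub>K x =
        c *\<^sub>K (B (y - f y *\<^sub>K e) + f y *\<^sub>K x)"
      using y by (simp add: operators_scale[OF B] kernel_part dual_ball_scale[OF f]
          scale_right_distrib)
  next
    fix y assume y: "y \<in> Y"
    have fy: "norm (f y) \<le> norm y" by (rule dual_ball_norm[OF f])
    have "norm (y - f y *\<^sub>K e) \<le> norm y + norm y * norm e"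
      using norm_triangle_ineq4[of y "f y *\<^sub>K e"] mult_right_mono[OF fy norm_ge_zero[of e]]
      by (simp add: norm_scale)
    then have "C * norm (y - f y *\<^sub>K e) \<le> C * (norm y + norm y * norm e)"
      using C(1) by simp
    moreover have "norm (f y) * norm x \<le> norm y * norm x"
      by (intro mult_right_mono fy) simp
    ultimately have "norm (B (y - f y *\<^sub>K e) + f y *\<^sub>K x) \<le>
        C * (norm y + norm y * norm e) + norm y * norm x"
      using norm_triangle_ineq[of "B (y - f y *\<^sub>K e)" "f y *\<^sub>K x"] C(2)[OF kernel_part[OF y]]
      by (simp add: norm_scale)
    then show "norm (B (y - f y *\<^sub>K e) + f y *\<^sub>K x) \<le> (C * (1 + norm e) + norm x) * norm y"
      by (simp add: algebra_simps)
  qed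
qed

lemma extend_restrict:
  assumes "A \<in> operators Y UNIV"
  shows "extend (restrict A Y0) (A e) = A"
proof
  fix y
  show "extend (restrict A Y0) (A e) y = A y"
  proof (cases "y \<in> Y")
    case True
    then show ?thesis
      using e kernel_part[OF True] Y
      by (simp add: extend_def operators_diff[OF Y assms] operators_scale[OF assms] subspace_scale)
  next
    case False
    then show ?thesis
      using operators_extensional[OF assms] by (simp add: extend_def extensional_def)
  qed
qed

lemma restrict_extend:
  assumes "B \<in> operators Y0 UNIV"
  shows "restrict (extend B x) Y0 = B"
proof
  fix y
  show "restrict (extend B x) Y0 y = B y"
    using operators_extensional[OF assms] kernel_subset
    by (cases "y \<in> Y0") (auto simp: extend_def Y0_def extensional_def)
qed

lemma extend_image:
  assumes "B \<in> operators Y0 UNIV"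
  shows "extend B x ` Y = {v + k *\<^sub>K x | v k. v \<in> B ` Y0}"
proof -
  have "B u + k *\<^sub>K x \<in> extend B x ` Y" if u: "u \<in> Y0" for u k
  proof (rule image_eqI)
    show "u + k *\<^sub>K e \<in> Y" using u kernel_subset e Y by (auto intro: subspace_add subspace_scale)
    have "f (u + k *\<^sub>K e) = k"
      using u e by (simp add: Y0_def dual_ball_add[OF f] dual_ball_scale[OF f])
    then show "B u + k *\<^sub>K x = extend B x (u + k *\<^sub>K e)"
      using \<open>u + k *\<^sub>K e \<in> Y\<close> by (simp add: extend_def)
  qed
  then show ?thesis using kernel_part by (auto simp: extend_def)
qed

text \<open>As \<open>f\<close> has norm at most 1, vanishes on \<open>Y0\<close> and is 1 at
  \<open>e\<close>, the distance of \<open>e\<close> to \<open>Y0\<close> is at least 1. The lower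
  bound of \<open>A\<close> carries this over to the images.\<close>

lemma Emb_apart:
  assumes "A \<in> Emb Y"
  obtains d where "0 < d" "\<And>y. y \<in> Y0 \<Longrightarrow> d \<le> norm (A e - A y)"
proof -
  obtain c where c: "0 < c" "\<And>y. y \<in> Y \<Longrightarrow> c * norm y \<le> norm (A y)"
    using Emb_lower[OF assms] by blast
  have "c \<le> norm (A e - A y)" if y: "y \<in> Y0" for y
  proof -
    have yY: "y \<in> Y" "f y = 0" using y by (auto simp: Y0_def)
    have "1 \<le> norm (e - y)"
      using dual_ball_norm[OF f, of "e - y"] e yY by (simp add: dual_ball_diff[OF f])
    then have "c \<le> c * norm (e - y)" using c(1) by simp
    also have "\<dots> \<le> norm (A (e - y))" using e yY Y by (intro c subspace_diff)
    finally show ?thesis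
      using e yY by (simp add: operators_diff[OF Y Emb_operators[OF assms]])
  qed
  then show thesis using that c(1) by blast
qed

text \<open>The distance of the moving vector from the moving image controls the coefficient
  \<open>f y\<close>, and the lower bound on \<open>Y0\<close> then controls the other component.
  Both constants are uniform in \<open>t\<close>.\<close>

lemma linked_extend:
  assumes B0: "B0 \<in> operators Y0 UNIV" and B1: "B1 \<in> operators Y0 UNIV" and cd: "0 < c" "0 < d"
    and lower: "\<And>t y. t \<in> {0..1} \<Longrightarrow> y \<in> Y0 \<Longrightarrow> c * norm y \<le> norm ((1 - t) *\<^sub>R B0 y + t *\<^sub>R B1 y)"
    and apart: "\<And>t y k. t \<in> {0..1} \<Longrightarrow> y \<in> Y0 \<Longrightarrow>
      norm k * d \<le> norm ((1 - t) *\<^sub>R B0 y + t *\<^sub>R B1 y + k *\<^sub>K ((1 - t) *\<^sub>R x0 + t *\<^sub>R x1))"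
  shows "linked Y (extend B0 x0) (extend B1 x1)"
proof -
  let ?M = "norm x0 + norm x1"
  \<comment> \<open>With \<open>N\<close> the norm of the image of \<open>y\<close>,
    \<open>apart\<close> bounds \<open>norm (f y)\<close> by \<open>N / d\<close>. The first summand
    then accounts for the component in \<open>Y0\<close>, the second for the multiple of
    \<open>e\<close>.\<close>
  let ?K = "(1 + ?M / d) / c + norm e / d"
  have "0 < (1 + ?M / d) / c" using cd by (intro divide_pos_pos add_pos_nonneg) auto
  moreover have "0 \<le> norm e / d" using cd by simp
  ultimately have K: "0 < ?K" by linarith
  show ?thesis
  proof (rule linkedI[where c = "1 / ?K"])
    fix t :: real and y assume t: "t \<in> {0..1}" and y: "y \<in> Y"
    let ?u = "y - f y *\<^sub>K e"
    define x where "x = (1 - t) *\<^sub>R x0 + t *\<^sub>R x1"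
    define v where "v = (1 - t) *\<^sub>R B0 ?u + t *\<^sub>R B1 ?u"
    define N where "N = norm (v + f y *\<^sub>K x)"
    have u: "?u \<in> Y0" by (rule kernel_part[OF y])
    have x: "norm x \<le> ?M"
    proof -
      have "norm x \<le> \<bar>1 - t\<bar> * norm x0 + \<bar>t\<bar> * norm x1"
        using norm_triangle_ineq[of "(1 - t) *\<^sub>R x0" "t *\<^sub>R x1"] by (simp add: x_def)
      also have "\<dots> \<le> 1 * norm x0 + 1 * norm x1" using t by (intro add_mono mult_right_mono) auto
      finally show ?thesis by simp
    qed
    have fd: "norm (f y) \<le> N / d"
      using apart[OF t u, of "f y"] cd by (simp add: N_def v_def x_def pos_le_divide_eq)
    have "norm v \<le> N + norm (f y) * norm x"
      using norm_triangle_ineq4[of "v + f y *\<^sub>K x" "f y *\<^sub>K x"] by (simp add: N_def norm_scale)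
    also have "norm (f y) * norm x \<le> N / d * ?M" using fd x cd by (intro mult_mono) (auto simp: N_def)
    finally have "c * norm ?u \<le> N + N / d * ?M" using lower[OF t u] by (simp add: v_def)
    then have nu: "norm ?u \<le> (N + N / d * ?M) / c" using cd by (simp add: pos_le_divide_eq mult.commute)
    have "norm y \<le> norm ?u + norm (f y) * norm e"
      using norm_triangle_ineq[of ?u "f y *\<^sub>K e"] by (simp add: norm_scale)
    also have "\<dots> \<le> (N + N / d * ?M) / c + N / d * norm e"
      using nu fd by (intro add_mono mult_right_mono) auto
    also have "\<dots> = ?K * N" using cd by (simp add: field_simps)
    finally have "1 / ?K * norm y \<le> N" using K by (simp add: pos_divide_le_eq mult.commute)
    also have "v + f y *\<^sub>K x = (1 - t) *\<^sub>R extend B0 x0 y + t *\<^sub>R extend B1 x1 y"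
      using y by (simp add: extend_def v_def x_def scale_right_distrib scaleR_right_distrib scale_scaleR)
    then have "N = norm ((1 - t) *\<^sub>R extend B0 x0 y + t *\<^sub>R extend B1 x1 y)" by (simp add: N_def)
    finally show "1 / ?K * norm y \<le> norm ((1 - t) *\<^sub>R extend B0 x0 y + t *\<^sub>R extend B1 x1 y)" .
  qed (use K extend_operators B0 B1 in auto)
qed

lemma image_subspace:
  assumes "B \<in> operators Y0 UNIV"
  shows "subspace (B ` Y0)"
proof -
  have "B u + B v \<in> B ` Y0" if "u \<in> Y0" "v \<in> Y0" for u v
    using that subspace_add[OF kernel_subspace] by (metis operators_add[OF assms] imageI)
  moreover have "c *\<^sub>K B u \<in> B ` Y0" if "u \<in> Y0" for u c
    using that subspace_scale[OF kernel_subspace] by (metis operators_scale[OF assms] imageI)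
  moreover have "0 \<in> B ` Y0"
    using subspace_0[OF kernel_subspace] operators_0[OF kernel_subspace assms] by (metis imageI)
  ultimately show ?thesis by (auto simp: subspace_def)
qed

text \<open>If \<open>B\<close> is close to \<open>A\<close> on \<open>Y0\<close>, first move \<open>A e\<close> within its class modulo \<open>A ` Y0\<close> to a vector
  \<open>x\<close> of norm at most twice its distance to \<open>A ` Y0\<close>; this \<open>x\<close> then stays away from the image of \<open>Y0\<close>
  while \<open>A\<close> moves to \<open>B\<close>.\<close>

lemma small_move_extends:
  assumes A: "A \<in> Emb Y" and B: "B \<in> operators Y0 UNIV" and c: "0 < c"
    and lower: "\<And>y. y \<in> Y0 \<Longrightarrow> c * norm y \<le> norm (A y)"
    and small: "\<And>y. y \<in> Y0 \<Longrightarrow> norm (A y - B y) \<le> c / 8 * norm y"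
  obtains A' where "A' \<in> Emb Y" "restrict A' Y0 = B" "(linked Y)\<^sup>*\<^sup>* A A'"
proof -
  define A0 where "A0 = restrict A Y0"
  let ?V = "A0 ` Y0"
  note Aop = Emb_operators[OF A]
  have A0: "A0 \<in> operators Y0 UNIV"
    unfolding A0_def by (rule operators_restrict[OF Aop kernel_subspace kernel_subset])
  have V: "subspace ?V" by (rule image_subspace[OF A0])
  define D where "D = infdist (A e) ?V"
  obtain d where d: "0 < d" "\<And>y. y \<in> Y0 \<Longrightarrow> d \<le> norm (A e - A y)" using Emb_apart[OF A] by blast
  have "d \<le> D"
    unfolding D_def using d(2) subspace_0[OF V]
    by (intro infdist_greatest) (auto simp: A0_def dist_norm)
  then have D: "0 < D" using d by simp
  \<comment> \<open>The distance may fail to be attained; as it is positive, some point is closer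
    than twice its value.\<close>
  have "\<exists>v\<in>?V. dist (A e) v < 2 * D"
  proof (rule ccontr)
    assume "\<not> ?thesis"
    then have "2 * D \<le> D" unfolding D_def using subspace_0[OF V]
      by (intro infdist_greatest) (auto simp: not_less D_def)
    then show False using D by simp
  qed
  then obtain v where v: "v \<in> ?V" "norm (A e - v) < 2 * D" by (auto simp: dist_norm)
  let ?x = "A e - v"
  \<comment> \<open>Since \<open>v\<close> lies in \<open>?V\<close>, subtracting multiples of it
    from \<open>A e\<close> does not change the distance to \<open>?V\<close>.\<close>
  have apart: "norm k * D \<le> norm (A0 y + k *\<^sub>K (A e - s *\<^sub>R v))" if "y \<in> Y0" for k y s
  proof -
    have "A0 y - k *\<^sub>K s *\<^sub>R v \<in> ?V"
      using that v(1) by (intro subspace_diff[OF V] subspace_scale[OF V] subspace_scaleR[OF V] imageI)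
    from norm_ge_infdist[OF V this order_refl, of k "A e"] show ?thesis
      by (simp add: D_def scale_right_diff_distrib algebra_simps)
  qed
  have lower0: "c * norm y \<le> norm (A0 y)" if "y \<in> Y0" for y
    using lower that by (simp add: A0_def)
  have "linked Y (extend A0 (A e)) (extend A0 ?x)"
  proof (rule linked_extend[OF A0 A0 c D])
    fix t :: real and y k assume "t \<in> {0..1}" and y: "y \<in> Y0"
    have eq: "(1 - t) *\<^sub>R A0 y + t *\<^sub>R A0 y = A0 y" by (simp add: algebra_simps)
    have eq': "(1 - t) *\<^sub>R A e + t *\<^sub>R ?x = A e - t *\<^sub>R v" by (simp add: algebra_simps)
    show "c * norm y \<le> norm ((1 - t) *\<^sub>R A0 y + t *\<^sub>R A0 y)" unfolding eq by (rule lower0[OF y])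
    show "norm k * D \<le> norm ((1 - t) *\<^sub>R A0 y + t *\<^sub>R A0 y + k *\<^sub>K ((1 - t) *\<^sub>R A e + t *\<^sub>R ?x))"
      unfolding eq eq' by (rule apart[OF y])
  qed
  moreover have "linked Y (extend A0 ?x) (extend B ?x)"
  proof (rule linked_extend[OF A0 B])
    show "0 < c * 7 / 8" "0 < D * 5 / 8" using c D by auto
    fix t :: real and y k assume t: "t \<in> {0..1}" and y: "y \<in> Y0"
    have eq: "(1 - t) *\<^sub>R A0 y + t *\<^sub>R B y = A0 y - t *\<^sub>R (A y - B y)"
      using y by (simp add: algebra_simps A0_def)
    have tAB: "norm (t *\<^sub>R (A y - B y)) \<le> c / 8 * norm y"
      using t small[OF y] mult_left_le_one_le[of "norm (A y - B y)" t] by simp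
    show "c * 7 / 8 * norm y \<le> norm ((1 - t) *\<^sub>R A0 y + t *\<^sub>R B y)"
      using norm_triangle_ineq2[of "A0 y" "t *\<^sub>R (A y - B y)"] tAB lower0[OF y] unfolding eq by linarith
    have eq': "(1 - t) *\<^sub>R ?x + t *\<^sub>R ?x = ?x" by (simp add: algebra_simps)
    let ?N = "norm (A0 y + k *\<^sub>K ?x)"
    have N: "norm k * D \<le> ?N" using apart[OF y, of k 1] by simp
    \<comment> \<open>As \<open>?x\<close> has norm at most \<open>2 * D\<close>, its multiple by
      \<open>k\<close> has norm at most \<open>2 * ?N\<close>. So \<open>A0 y\<close> has norm at
      most \<open>3 * ?N\<close>, and the perturbation by \<open>A y - B y\<close> costs at most
      \<open>3 / 8 * ?N\<close>.\<close>
    have "norm k * norm ?x \<le> norm k * (2 * D)" using v(2) by (intro mult_left_mono) auto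
    then have "norm (A0 y) \<le> 3 * ?N"
      using norm_triangle_ineq4[of "A0 y + k *\<^sub>K ?x" "k *\<^sub>K ?x"] N by (simp add: norm_scale)
    then have "c / 8 * norm y \<le> 3 / 8 * ?N" using lower0[OF y] by simp
    then have "5 / 8 * ?N \<le> norm (A0 y + k *\<^sub>K ?x - t *\<^sub>R (A y - B y))"
      using norm_triangle_ineq2[of "A0 y + k *\<^sub>K ?x" "t *\<^sub>R (A y - B y)"] tAB by linarith
    then have "5 / 8 * ?N \<le> norm (A0 y - t *\<^sub>R (A y - B y) + k *\<^sub>K ?x)"
      by (simp add: algebra_simps)
    then show "norm k * (D * 5 / 8) \<le>
        norm ((1 - t) *\<^sub>R A0 y + t *\<^sub>R B y + k *\<^sub>K ((1 - t) *\<^sub>R ?x + t *\<^sub>R ?x))"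
      unfolding eq eq' using N by simp
  qed
  ultimately have linked: "(linked Y)\<^sup>*\<^sup>* A (extend B ?x)" "linked Y (extend A0 ?x) (extend B ?x)"
    using extend_restrict[OF Aop] by (auto simp: A0_def)
  then show thesis
    using that[of "extend B ?x"] linked_Emb_endpoints[OF Y] restrict_extend[OF B] by blast
qed

text \<open>The segment on \<open>Y0\<close> is cut into pieces short enough for
  \<open>small_move_extends\<close>. The endpoint of the lift is prescribed on \<open>Y0\<close>
  only; its value at \<open>e\<close> is left free.\<close>

lemma linked_lifts:
  assumes "linked Y0 A0 B0" "A \<in> Emb Y" "restrict A Y0 = A0"
  shows "\<exists>B\<in>Emb Y. restrict B Y0 = B0 \<and> (linked Y)\<^sup>*\<^sup>* A B"
proof -
  have ops: "A0 \<in> operators Y0 UNIV" "B0 \<in> operators Y0 UNIV" using assms(1) by (auto simp: linked_def)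
  obtain c where c: "0 < c"
    "\<And>t y. t \<in> {0..1} \<Longrightarrow> y \<in> Y0 \<Longrightarrow> c * norm y \<le> norm ((1 - t) *\<^sub>R A0 y + t *\<^sub>R B0 y)"
    using assms(1) unfolding linked_def by blast
  define P where "P t = (\<lambda>y\<in>Y0. (1 - t) *\<^sub>R A0 y + t *\<^sub>R B0 y)" for t :: real
  have P_op: "P t \<in> operators Y0 UNIV" for t
    unfolding P_def by (rule operators_lincomb[OF kernel_subspace ops])
  obtain a b where ab: "0 < a" "\<And>y. y \<in> Y0 \<Longrightarrow> norm (A0 y) \<le> a * norm y"
    "0 < b" "\<And>y. y \<in> Y0 \<Longrightarrow> norm (B0 y) \<le> b * norm y"
    using operators_bound[OF ops(1)] operators_bound[OF ops(2)] by metis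
  \<comment> \<open>One of \<open>n\<close> equal pieces changes the operator by at most
    \<open>(a + b) / n\<close>, which has to be at most \<open>c / 8\<close>.\<close>
  obtain n :: nat where n: "(a + b) * 8 / c < n" using reals_Archimedean2 by blast
  have "0 < (a + b) * 8 / c" using ab c by simp
  then have n0: "0 < real n" using n by linarith
  have "\<exists>B\<in>Emb Y. restrict B Y0 = P (k / n) \<and> (linked Y)\<^sup>*\<^sup>* A B" if "k \<le> n" for k :: nat
    using that
  proof (induction k)
    case 0
    have "P 0 = A0" unfolding P_def by (rule linked_endpoints[OF ops])
    then show ?case using assms(2,3) by (intro bexI[of _ A]) simp_all
  next
    case (Suc k)
    from Suc.IH[OF Suc_leD[OF Suc.prems]]
    obtain B where B: "B \<in> Emb Y" "restrict B Y0 = P (k / n)" "(linked Y)\<^sup>*\<^sup>* A B" by blast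
    have BP: "B y = P (k / n) y" if "y \<in> Y0" for y using B(2) that by (metis restrict_apply')
    obtain B' where "B' \<in> Emb Y" "restrict B' Y0 = P (Suc k / n)" "(linked Y)\<^sup>*\<^sup>* B B'"
    proof (rule small_move_extends[OF B(1) P_op c(1)])
      fix y assume y: "y \<in> Y0"
      have "real k / real n \<in> {0..1}" using Suc.prems n0 by simp
      then show "c * norm y \<le> norm (B y)" using c(2) y by (simp add: BP P_def)
      have "B y - P (Suc k / n) y = (Suc k / n - k / n) *\<^sub>R (A0 y - B0 y)"
        using y by (simp add: BP P_def algebra_simps)
      also have "real (Suc k) / n - k / n = 1 / n" by (simp add: diff_divide_distrib[symmetric])
      finally have "norm (B y - P (Suc k / n) y) = norm (A0 y - B0 y) / n" by simp
      also have "\<dots> \<le> (a + b) * norm y / n"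
        using norm_triangle_ineq4[of "A0 y" "B0 y"] ab(2,4)[OF y] n0
        by (intro divide_right_mono) (auto simp: algebra_simps)
      also have "\<dots> = (a + b) / n * norm y" by simp
      also have "\<dots> \<le> c / 8 * norm y"
        using n n0 c(1) by (intro mult_right_mono) (auto simp: field_simps)
      finally show "norm (B y - P (Suc k / n) y) \<le> c / 8 * norm y" .
    qed (rule that)
    then show ?case using B(3) by (meson rtranclp_trans)
  qed
  from this[of n] n0 have "\<exists>B\<in>Emb Y. restrict B Y0 = P 1 \<and> (linked Y)\<^sup>*\<^sup>* A B" by simp
  moreover have "P 1 = B0" unfolding P_def by (rule linked_endpoints[OF ops])
  ultimately show ?thesis by simp
qed

lemma linked_rtranclp_lifts:
  assumes "(linked Y0)\<^sup>*\<^sup>* A0 B0" "A \<in> Emb Y" "restrict A Y0 = A0"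
  shows "\<exists>B\<in>Emb Y. restrict B Y0 = B0 \<and> (linked Y)\<^sup>*\<^sup>* A B"
  using assms(1)
proof (induction rule: rtranclp_induct)
  case base
  then show ?case using assms(2,3) by blast
next
  case (step B0 C0)
  then show ?case using linked_lifts by (meson rtranclp_trans)
qed

text \<open>Since the images of \<open>Y0\<close> agree, only the value at \<open>e\<close> has to
  move. A segment from \<open>B e\<close> to \<open>T e\<close> or to \<open>- T e\<close> stays
  away from the closure of the common image, and either end gives the same image of
  \<open>Y\<close>.\<close>

lemma extend_with_same_image:
  assumes T: "T \<in> Emb Y" and B: "B \<in> Emb Y" and eq: "B ` Y0 = T ` Y0"
  shows "\<exists>B'\<in>Emb Y. B' ` Y = T ` Y \<and> linked Y B B'"
proof -
  define B0 where "B0 = restrict B Y0"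
  note Bop = Emb_operators[OF B]
  have B0E: "B0 \<in> Emb Y0"
    unfolding B0_def by (rule Emb_restrict[OF B kernel_subspace kernel_subset])
  then have B0: "B0 \<in> operators Y0 UNIV" by (rule Emb_operators)
  define T0 where "T0 = restrict T Y0"
  have T0: "T0 \<in> operators Y0 UNIV"
    unfolding T0_def by (rule operators_restrict[OF Emb_operators[OF T] kernel_subspace kernel_subset])
  let ?V = "B0 ` Y0"
  have VT: "?V = T0 ` Y0" and VB: "?V = B ` Y0" using eq by (simp_all add: B0_def T0_def)
  have V: "subspace ?V" by (rule image_subspace[OF B0])
  \<comment> \<open>The segment argument takes place in the underlying real space, so the closure is
    regarded as a real subspace.\<close>
  have clV: "Real_Vector_Spaces.subspace (closure ?V)"
    using subspace_closure[OF V]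
    by (simp add: Real_Vector_Spaces.subspace_def subspace_0 subspace_add subspace_scaleR)
  have notin: "A e \<notin> closure ?V" if A: "A \<in> Emb Y" and VA: "?V = A ` Y0" for A
  proof
    assume in_cl: "A e \<in> closure ?V"
    obtain d where d: "0 < d" "\<And>y. y \<in> Y0 \<Longrightarrow> d \<le> norm (A e - A y)" using Emb_apart[OF A] by blast
    obtain v where v: "v \<in> ?V" "dist v (A e) < d" using in_cl d(1) unfolding closure_approachable by blast
    then obtain y where "y \<in> Y0" "v = A y" unfolding VA by blast
    then show False using d(2)[of y] v(2) by (simp add: dist_norm norm_minus_commute)
  qed
  obtain \<sigma> d :: real where \<sigma>: "\<sigma> = 1 \<or> \<sigma> = -1" and d: "0 < d"
    "\<And>t. t \<in> {0..1} \<Longrightarrow> d \<le> infdist ((1 - t) *\<^sub>R B e + t *\<^sub>R \<sigma> *\<^sub>R T e) (closure ?V)"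
    using segment_avoids_subspace[OF clV closed_closure notin[OF B VB] notin[OF T]] eq VB by metis
  obtain c where c: "0 < c" "\<And>y. y \<in> Y0 \<Longrightarrow> c * norm y \<le> norm (B0 y)"
    using Emb_lower[OF B0E] by blast
  have linked: "linked Y (extend B0 (B e)) (extend B0 (\<sigma> *\<^sub>R T e))"
  proof (rule linked_extend[OF B0 B0 c(1) d(1)])
    fix t :: real and y and k :: 'k assume t: "t \<in> {0..1}" and y: "y \<in> Y0"
    have eq: "(1 - t) *\<^sub>R B0 y + t *\<^sub>R B0 y = B0 y" by (simp add: algebra_simps)
    show "c * norm y \<le> norm ((1 - t) *\<^sub>R B0 y + t *\<^sub>R B0 y)" unfolding eq by (rule c(2)[OF y])
    have "norm k * d \<le> norm k * infdist ((1 - t) *\<^sub>R B e + t *\<^sub>R \<sigma> *\<^sub>R T e) (closure ?V)"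
      by (intro mult_left_mono d(2)[OF t]) simp
    also have "\<dots> \<le> norm (B0 y + k *\<^sub>K ((1 - t) *\<^sub>R B e + t *\<^sub>R \<sigma> *\<^sub>R T e))"
      using y by (intro norm_ge_infdist[OF V] closure_subset) auto
    finally show "norm k * d \<le>
        norm ((1 - t) *\<^sub>R B0 y + t *\<^sub>R B0 y + k *\<^sub>K ((1 - t) *\<^sub>R B e + t *\<^sub>R \<sigma> *\<^sub>R T e))"
      unfolding eq .
  qed
  have "extend B0 (\<sigma> *\<^sub>R T e) ` Y = {v + k *\<^sub>K \<sigma> *\<^sub>R T e | v k. v \<in> ?V}" by (rule extend_image[OF B0])
  also have "\<dots> = {v + k *\<^sub>K T e | v k. v \<in> ?V}"
  proof -
    have 1: "k *\<^sub>K \<sigma> *\<^sub>R T e = (k * of_real \<sigma>) *\<^sub>K T e" for k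
      by (simp add: scaleR_eq_scale)
    \<comment> \<open>The sign is absorbed into the scalar, as its square is 1.\<close>
    have 2: "k *\<^sub>K T e = (k * of_real \<sigma>) *\<^sub>K \<sigma> *\<^sub>R T e" for k
      using \<sigma> by (auto simp: scaleR_eq_scale)
    have "\<exists>u l. v + k *\<^sub>K \<sigma> *\<^sub>R T e = u + l *\<^sub>K T e \<and> u \<in> ?V" if "v \<in> ?V" for v k
      unfolding 1 using that by blast
    moreover have "\<exists>u l. v + k *\<^sub>K T e = u + l *\<^sub>K \<sigma> *\<^sub>R T e \<and> u \<in> ?V" if "v \<in> ?V" for v k
      by (subst 2) (use that in blast)
    ultimately show ?thesis by blast
  qed
  also have "\<dots> = extend T0 (T e) ` Y" unfolding VT by (rule extend_image[OF T0, symmetric])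
  also have "extend T0 (T e) = T" unfolding T0_def by (rule extend_restrict[OF Emb_operators[OF T]])
  finally have "extend B0 (\<sigma> *\<^sub>R T e) ` Y = T ` Y" .
  moreover have "extend B0 (B e) = B" unfolding B0_def by (rule extend_restrict[OF Bop])
  ultimately show ?thesis using linked linked_Emb_endpoints[OF Y linked] by auto
qed

end

text \<open>Only the image of \<open>T\<close> is prescribed for the end of the chain. Each added
  dimension may end at \<open>- T e\<close> in place of \<open>T e\<close>, and this weaker
  condition survives it.\<close>

definition reachable_image :: "('a \<Rightarrow> 'a) \<Rightarrow> 'a set \<Rightarrow> bool" where
  "reachable_image T V \<longleftrightarrow> (\<exists>B\<in>Emb V. B ` V = T ` V \<and> (linked V)\<^sup>*\<^sup>* (inclusion V) B)"

text \<open>The chain on the kernel lifts to \<open>V\<close> without control over its endpoint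
  outside the kernel; one further segment restores the image. If \<open>f\<close> vanishes on
  \<open>V\<close>, the kernel is \<open>V\<close> itself.\<close>

lemma reachable_image_hyperplane:
  assumes V: "subspace V" and T: "T \<in> Emb V" and f: "f \<in> dual_ball"
    and kernel: "reachable_image T {y \<in> V. f y = 0}"
  shows "reachable_image T V"
proof (cases "\<exists>e\<in>V. f e \<noteq> 0")
  case False
  then have "{y \<in> V. f y = 0} = V" by auto
  then show ?thesis using kernel by simp
next
  case True
  then obtain e0 where e0: "e0 \<in> V" "f e0 \<noteq> 0" by blast
  define e where "e = inverse (f e0) *\<^sub>K e0"
  have e: "e \<in> V" "f e = 1"
    using e0 V by (auto simp: e_def subspace_scale dual_ball_scale[OF f])
  let ?V0 = "{y \<in> V. f y = 0}"
  obtain B0 where B0: "B0 \<in> Emb ?V0" "B0 ` ?V0 = T ` ?V0" "(linked ?V0)\<^sup>*\<^sup>* (inclusion ?V0) B0"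
    using kernel unfolding reachable_image_def by blast
  have "restrict (inclusion V) ?V0 = inclusion ?V0" by (auto simp: inclusion_def)
  then obtain B where B: "B \<in> Emb V" "restrict B ?V0 = B0" "(linked V)\<^sup>*\<^sup>* (inclusion V) B"
    using linked_rtranclp_lifts[OF V f e B0(3) inclusion_in_Emb[OF V]] by blast
  have "B ` ?V0 = T ` ?V0" using B(2) B0(2) by (metis image_restrict_eq)
  then show ?thesis
    using extend_with_same_image[OF V f e T B(1)] B(3)
    unfolding reachable_image_def by (meson rtranclp.rtrancl_into_rtrancl)
qed

text \<open>The functionals are dropped one at a time, each enlarging the subspace by at most one
  dimension.\<close>

lemma reachable_image_finite_codim:
  assumes Y: "subspace Y" and T: "T \<in> Emb Y" and "finite \<Phi>" "\<Phi> \<subseteq> dual_ball"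
    and "reachable_image T {y \<in> Y. \<forall>f\<in>\<Phi>. f y = 0}"
  shows "reachable_image T Y"
  using assms(3-5)
proof (induction \<Phi> rule: finite_induct)
  case empty
  then show ?case by simp
next
  case (insert f \<Phi>)
  let ?V = "{y \<in> Y. \<forall>f\<in>\<Phi>. f y = 0}"
  have V: "subspace ?V"
    using Y insert.prems(1)
    by (auto simp: subspace_def dual_ball_0 dual_ball_add dual_ball_scale subset_iff)
  have TV: "restrict T ?V \<in> Emb ?V" by (rule Emb_restrict[OF T V]) auto
  \<comment> \<open>Embeddings are extensional, so \<open>T\<close> has to be restricted to become
    an embedding of \<open>?V\<close>; reachability sees only its values on
    \<open>W\<close>.\<close>
  have eq: "reachable_image (restrict T ?V) W = reachable_image T W" if "W \<subseteq> ?V" for W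
  proof -
    have "restrict T ?V ` W = T ` W" using that by (auto simp: image_def subset_iff)
    then show ?thesis by (simp add: reachable_image_def)
  qed
  have "{y \<in> ?V. f y = 0} = {y \<in> Y. \<forall>f\<in>insert f \<Phi>. f y = 0}" by auto
  then have "reachable_image T {y \<in> ?V. f y = 0}" using insert.prems(2) by simp
  then have "reachable_image (restrict T ?V) {y \<in> ?V. f y = 0}" by (subst eq) auto
  then have "reachable_image (restrict T ?V) ?V"
    using insert.prems(1) by (intro reachable_image_hyperplane[OF V TV, of f]) auto
  then have "reachable_image T ?V" by (simp add: eq)
  then show ?case using insert by auto
qed

end

section \<open>The theorem for scalars with norming functionals\<close>

context hahn_banach_space
begin

theorem HI_isomorphic_subspaces_homotopic:
  assumes HI: hereditarily_indecomposable
    and Y: "inf_dim_closed_subspace Y" and iso: "isomorphic Y Z"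
  shows "\<exists>T\<in>Emb Y. T ` Y = Z \<and> homotopic_in_Emb Y T (inclusion Y)"
proof -
  have sub: "subspace Y" "closed Y" using Y by (auto simp: inf_dim_closed_subspace_def)
  obtain T0 S where T0: "T0 \<in> operators Y Z" and S: "S \<in> operators Z Y"
    and inv: "\<And>y. y \<in> Y \<Longrightarrow> S (T0 y) = y" "\<And>z. z \<in> Z \<Longrightarrow> T0 (S z) = z"
    using iso unfolding isomorphic_def by blast
  have maps: "\<And>y. y \<in> Y \<Longrightarrow> T0 y \<in> Z" "\<And>z. z \<in> Z \<Longrightarrow> S z \<in> Y"
    using T0 S by (auto simp: operators_def)
  have image0: "T0 ` Y = Z" using maps inv by (auto simp: image_iff) metis
  have "T0 \<in> Emb Y"
  proof -
    obtain C where C: "0 < C" "\<And>z. z \<in> Z \<Longrightarrow> norm (S z) \<le> C * norm z"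
      using operators_bound[OF S] by blast
    show ?thesis
    proof (rule EmbI)
      show "T0 \<in> operators Y UNIV" using T0 by (auto simp: operators_def PiE_def)
      show "0 < 1 / C" using C by simp
      show "1 / C * norm y \<le> norm (T0 y)" if "y \<in> Y" for y
        using C(2)[OF maps(1)[OF that]] C(1) inv(1)[OF that] by (simp add: divide_le_eq mult.commute)
    qed
  qed
  obtain \<sigma> where \<sigma>: "\<sigma> = 1 \<or> \<sigma> = -1"
    "\<And>t. t \<in> {0..1} \<Longrightarrow> finitely_singular Y (\<lambda>y\<in>Y. (1 - t) *\<^sub>R y + t *\<^sub>R \<sigma> *\<^sub>R T0 y)"
    using segment_finitely_singular[OF HI sub \<open>T0 \<in> Emb Y\<close>] by blast
  \<comment> \<open>The zero summand gives the multiple of \<open>T0\<close> the form of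
    \<open>operators_lincomb\<close>.\<close>
  define T where "T = (\<lambda>y\<in>Y. \<sigma> *\<^sub>R T0 y + 0 *\<^sub>R T0 y)"
  have T_app: "T y = \<sigma> *\<^sub>R T0 y" if "y \<in> Y" for y using that by (simp add: T_def)
  have T: "T \<in> Emb Y"
  proof -
    obtain c where c: "0 < c" "\<And>y. y \<in> Y \<Longrightarrow> c * norm y \<le> norm (T0 y)"
      using Emb_lower[OF \<open>T0 \<in> Emb Y\<close>] by blast
    have "T \<in> operators Y UNIV" unfolding T_def by (rule operators_lincomb[OF sub(1) T0 T0])
    then show ?thesis using c \<sigma>(1) by (intro EmbI[of _ _ c]) (auto simp: T_app)
  qed
  have image: "T ` Y = Z"
  proof -
    have "T0 y \<in> T ` Y" if "y \<in> Y" for y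
    proof (rule image_eqI)
      show "\<sigma> *\<^sub>R y \<in> Y" using that by (simp add: subspace_scaleR[OF sub(1)])
      then show "T0 y = T (\<sigma> *\<^sub>R y)"
        using that \<sigma>(1) by (auto simp: T_app operators_scaleR[OF T0])
    qed
    moreover have "T y \<in> T0 ` Y" if "y \<in> Y" for y
      using that by (simp add: T_app subspace_scaleR[OF sub(1)] flip: operators_scaleR[OF T0])
    ultimately show ?thesis unfolding image0[symmetric] by blast
  qed
  have path: "(\<lambda>y\<in>Y. (1 - t) *\<^sub>R y + t *\<^sub>R \<sigma> *\<^sub>R T0 y) = (\<lambda>y\<in>Y. (1 - t) *\<^sub>R y + t *\<^sub>R T y)" for t
    by (auto simp: T_app)
  obtain \<Phi> c where \<Phi>: "finite \<Phi>" "\<Phi> \<subseteq> dual_ball" and c: "0 < c"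
    "\<And>t y. t \<in> {0..1} \<Longrightarrow> y \<in> Y \<Longrightarrow> \<forall>f\<in>\<Phi>. f y = 0 \<Longrightarrow>
      c * norm y \<le> norm ((1 - t) *\<^sub>R y + t *\<^sub>R T y)"
    using segment_uniformly_finitely_singular[OF sub(1) Emb_operators[OF T] \<sigma>(2)[unfolded path]]
    by blast
  let ?V = "{y \<in> Y. \<forall>f\<in>\<Phi>. f y = 0}"
  have V: "subspace ?V"
    using sub(1) \<Phi>(2)
    by (auto simp: subspace_def dual_ball_0 dual_ball_add dual_ball_scale subset_iff)
  have TV: "restrict T ?V \<in> Emb ?V" by (rule Emb_restrict[OF T V]) auto
  \<comment> \<open>On \<open>?V\<close> the whole segment from the inclusion to \<open>T\<close> is
    a single link; this starts the induction on the codimension.\<close>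
  have "linked ?V (inclusion ?V) (restrict T ?V)"
    by (rule linkedI[OF Emb_operators[OF inclusion_in_Emb[OF V]] Emb_operators[OF TV] c(1)])
      (simp add: inclusion_def c(2))
  moreover have "restrict T ?V ` ?V = T ` ?V" by (rule image_restrict_eq)
  ultimately have "reachable_image T ?V"
    unfolding reachable_image_def using TV by blast
  then have "reachable_image T Y" by (rule reachable_image_finite_codim[OF sub(1) T \<Phi>])
  then obtain B where B: "B \<in> Emb Y" "B ` Y = T ` Y" "(linked Y)\<^sup>*\<^sup>* (inclusion Y) B"
    unfolding reachable_image_def by blast
  have "path_component_of (Emb_topology Y) (inclusion Y) B"
    by (rule linked_rtranclp_path[OF sub(1) B(3) inclusion_in_Emb[OF sub(1)]])
  then have "homotopic_in_Emb Y B (inclusion Y)"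
    unfolding homotopic_in_Emb_def
    using path_component_of_sym[of "Emb_topology Y" "inclusion Y" B] by (simp add: path_component_of_def)
  then show ?thesis using B image by auto
qed

end

section \<open>Real and complex scalars\<close>

lemma hahn_banach_space_real: "hahn_banach_space (scaleR :: real \<Rightarrow> 'a::banach \<Rightarrow> 'a)"
proof -
  interpret banach_space "scaleR :: real \<Rightarrow> 'a \<Rightarrow> 'a" by (rule banach_space_real)
  show ?thesis
  proof
    fix w :: 'a
    obtain f :: "'a \<Rightarrow> real" where "linear f" "\<And>x. \<bar>f x\<bar> \<le> norm x" "f w = norm w"
      by (rule real_norming_functional[of w]) (rule that)
    then show "\<exists>f. (\<forall>x y. f (x + y) = f x + f y) \<and> (\<forall>c x. f (c *\<^sub>R x) = c * f x) \<and>
      (\<forall>x. norm (f x) \<le> norm x) \<and> f w = of_real (norm w)"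
      by (intro exI[of _ f]) (simp add: linear_add linear_scale)
  qed
qed

text \<open>A real norming functional \<open>f\<close> is complexified as f(x) - i f(ix), which is
  complex linear with real part \<open>f\<close>.\<close>

lemma hahn_banach_space_complex:
  fixes scaleC :: "complex \<Rightarrow> 'a::banach \<Rightarrow> 'a"
  assumes "banach_space scaleC"
  shows "hahn_banach_space scaleC"
proof -
  interpret banach_space scaleC by (rule assms)
  show ?thesis
  proof
    fix w :: 'a
    obtain f :: "'a \<Rightarrow> real" where f: "linear f" "\<And>x. \<bar>f x\<bar> \<le> norm x" "f w = norm w"
      by (rule real_norming_functional[of w]) (rule that)
    define g where "g x = Complex (f x) (- f (scaleC \<i> x))" for x
    have add: "g (x + y) = g x + g y" for x y
      by (simp add: g_def scale_right_distrib linear_add[OF f(1)] complex_eq_iff)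
    have i: "scaleC \<i> (scaleC \<i> x) = - x" for x by simp
    have scale: "g (scaleC c x) = c * g x" for c x
    proof -
      have c: "scaleC c x = Re c *\<^sub>R x + Im c *\<^sub>R scaleC \<i> x"
      proof -
        have "scaleC c x = scaleC (of_real (Re c) + of_real (Im c) * \<i>) x"
          by (simp add: complex_eq_iff)
        then show ?thesis by (simp only: scale_left_distrib scale_scale[symmetric] scale_of_real)
      qed
      have "scaleC \<i> (scaleC c x) = Re c *\<^sub>R scaleC \<i> x - Im c *\<^sub>R x"
        unfolding c by (simp only: scale_right_distrib scale_scaleR i) simp
      then have "f (scaleC \<i> (scaleC c x)) = Re c * f (scaleC \<i> x) - Im c * f x"
        by (simp only: linear_diff[OF f(1)] linear_scale[OF f(1)] real_scaleR_def)
      moreover have "f (scaleC c x) = Re c * f x + Im c * f (scaleC \<i> x)"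
        unfolding c by (simp only: linear_add[OF f(1)] linear_scale[OF f(1)] real_scaleR_def)
      ultimately show ?thesis
        unfolding g_def by (simp only: complex_eq_iff) simp
    qed
    have bound: "norm (g x) \<le> norm x" for x
    proof (cases "g x = 0")
      case False
      \<comment> \<open>Multiplication by the unimodular \<open>u\<close> turns \<open>g x\<close>
        into its modulus, so only the real part \<open>f\<close> has to be bounded.\<close>
      define u where "u = of_real (norm (g x)) / g x"
      have u: "u * g x = of_real (norm (g x))" "norm u = 1"
        using False by (simp_all add: u_def norm_divide)
      have "norm (g x) = Re (g (scaleC u x))" unfolding scale u by simp
      also have "\<dots> = f (scaleC u x)" by (simp add: g_def)
      also have "\<dots> \<le> norm x" using f(2)[of "scaleC u x"] u(2) by (simp add: norm_scale)
      finally show ?thesis .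
    qed simp
    have Re: "Re (g w) = norm w" by (simp add: g_def f(3))
    \<comment> \<open>The real part of \<open>g w\<close> already exhausts the bound on its modulus,
      which forces the imaginary part to vanish.\<close>
    have "(norm (g w))\<^sup>2 \<le> (norm w)\<^sup>2" using bound[of w] by (intro power_mono) auto
    then have "Im (g w) = 0" unfolding cmod_power2 Re by simp
    with Re have "g w = of_real (norm w)" by (simp add: complex_eq_iff)
    then show "\<exists>f. (\<forall>x y. f (x + y) = f x + f y) \<and> (\<forall>c x. f (scaleC c x) = c * f x) \<and>
      (\<forall>x. norm (f x) \<le> norm x) \<and> f w = of_real (norm w)"
      using add scale bound by blast
  qed
qed

theorem theorem5p1:
  fixes Y Z :: "'a::banach set"
    and scaleC :: "complex \<Rightarrow> 'a \<Rightarrow> 'a"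
  shows
    "(banach_space.hereditarily_indecomposable (scaleR :: real \<Rightarrow> 'a \<Rightarrow> 'a) \<and>
      banach_space.inf_dim_closed_subspace (scaleR :: real \<Rightarrow> 'a \<Rightarrow> 'a) Y \<and>
      banach_space.inf_dim_closed_subspace (scaleR :: real \<Rightarrow> 'a \<Rightarrow> 'a) Z \<and>
      banach_space.isomorphic (scaleR :: real \<Rightarrow> 'a \<Rightarrow> 'a) Y Z \<longrightarrow>
        (\<exists>T \<in> banach_space.Emb (scaleR :: real \<Rightarrow> 'a \<Rightarrow> 'a) Y.
          T ` Y = Z \<and>
          banach_space.homotopic_in_Emb (scaleR :: real \<Rightarrow> 'a \<Rightarrow> 'a) Y T
            (inclusion Y)))
     \<and>
     (banach_space scaleC \<and>
      banach_space.hereditarily_indecomposable scaleC \<and>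
      banach_space.inf_dim_closed_subspace scaleC Y \<and>
      banach_space.inf_dim_closed_subspace scaleC Z \<and>
      banach_space.isomorphic scaleC Y Z \<longrightarrow>
        (\<exists>T \<in> banach_space.Emb scaleC Y.
          T ` Y = Z \<and>
          banach_space.homotopic_in_Emb scaleC Y T (inclusion Y)))"
  using hahn_banach_space.HI_isomorphic_subspaces_homotopic[OF hahn_banach_space_real]
    hahn_banach_space.HI_isomorphic_subspaces_homotopic[OF hahn_banach_space_complex]
  by blast

end
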